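(* Let $Q$ be a face operator and let $\overline Q\in\mathcal Q_{\infty_W,1}$, an operator on $\mathcal W_W\oplus\mathcal W_W\oplus\mathcal H_2$ (sides South, North, East), with blocks $B_{ab}$, $a,b\in\{S,N,E\}$. Then $\overline Q$ is a West fixed point of $Q$ with identity morphisms if and only if, setting $K=B_{EE}+Q_{WW}$, one has for all $a,b\in\{S,N\}$ $$B_{EE}=Q_{EE}-Q_{EW}K^{-1}Q_{WE},$$ $$B_{aE}=D^L_1\begin{pmatrix}-B_{aE}K^{-1}Q_{WE}\\ Q_{aE}-Q_{aW}K^{-1}Q_{WE}\end{pmatrix},$$ $$B_{ab}=D^L_1\left[\begin{pmatrix}B_{ab}&0\\ 0&Q_{ab}\end{pmatrix}-\begin{pmatrix}B_{aE}\\ Q_{aW}\end{pmatrix}K^{-1}\begin{pmatrix}B_{Eb}&Q_{Wb}\end{pmatrix}\right](D^L_1)^*,$$ where the column (resp. matrix) blocks refer to the decomposition $\mathcal W_W\oplus\mathcal H_1$.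
   Context: $\mathcal H_1,\mathcal H_2$ are finite-dimensional (real or complex) Hilbert spaces. A face operator is a self-adjoint positive definite operator $Q$ on $\mathcal H_1\oplus\mathcal H_1\oplus\mathcal H_2\oplus\mathcal H_2$, the four summands being attached to the South, North, West, East sides ($S,N,W,E$) of a unit square; $Q_{ab}$ are its blocks. Schur complement: for $M=\begin{pmatrix}M_{11}&M_{12}\\ M_{21}&M_{22}\end{pmatrix}$ on $V_1\oplus V_2$ with $M_{22}$ invertible, $\mathrm{Schur}_{V_2}(M)=M_{11}-M_{12}M_{22}^{-1}M_{21}$. Rectangles: $\mathcal Q_{p,q}$ ($p,q\ge1$) is the set of self-adjoint positive definite operators on $\mathcal H_1^{p}\oplus\mathcal H_1^p\oplus\mathcal H_2^{q}\oplus\mathcal H_2^q$ (sides $S,N,W,E$; $S,N$ ordered from left to right, $W,E$ from bottom to top). West half-strips: $\mathcal W_W=\ell^2(\mathbb Z_{<0};\mathcal H_1)$, and $\mathcal Q_{\infty_W,q}$ is the set of bounded self-adjoint operators $M$ on $\mathcal W_W\oplus\mathcal W_W\oplus\mathcal H_2^q$ (sides $S,N,E$) with $\inf_{x\ne0}\langle x,Mx\rangle/\langle x,x\rangle>0$. Shifts: $D_p^L:\mathcal W_W\oplus\mathcal H_1^p\to\mathcal W_W$ is the unitary $D^L_p(w,h)(k)=h_{k+1+p}$ for $-p\le k<0$ and $=w(k+p)$ for $k<-p$. Gluing: two adjacent shapes with operators $M,M'$ sharing a full side with space $V$ are glued by adding the two quadratic forms with a common variable on the shared side and taking the Schur complement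 with respect to $V$. Segments are concatenated via $\mathcal H_i^{p}\oplus\mathcal H_i^{p'}=\mathcal H_i^{p+p'}$. When $M\in\mathcal Q_{\infty_W,q}$ is glued along its East side to the West side of $P\in\mathcal Q_{p,q}$, the resulting operator on $(\mathcal W_W\oplus\mathcal H_1^p)\oplus(\mathcal W_W\oplus\mathcal H_1^p)\oplus\mathcal H_2^q$ is conjugated by the unitary $D^L_p\oplus D_p^L\oplus\mathrm{id}$, giving an element $M|P\in\mathcal Q_{\infty_W,q}$. Let $Q^{[p,q]}\in\mathcal Q_{p,q}$ be the result of gluing $p\times q$ copies of $Q$ along a grid, and $\overline Q^{[\infty_W,q]}\in\mathcal Q_{\infty_W,q}$ the result of stacking vertically $q$ copies of $\overline Q\in\mathcal Q_{\infty_W,1}$ (North side of each copy glued to the South side of the next). Definition: $\overline Q\in\mathcal Q_{\infty_W,1}$ is a West fixed point of $Q$ with identity morphisms if for all $p,q\ge1$: $\overline Q^{[\infty_W,q]}|Q^{[p,q]}=\overline Q^{[\infty_W,q]}$, and for all $r\ge1$ and all $B\in\mathcal Q_{r,q}$: $(\overline Q^{[\infty_W,q]}|Q^{[p,q]})|B=\overline Q^{[\infty_W,q]}|B$. *)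

theory Defs
  imports "HOL-Analysis.Analysis" "HOL-Library.Function_Algebras"
begin

text \<open>
  The scalar field. The axioms give \<open>z\<^sup>2 - (z + conjg z) z + \<bar>z\<bar>\<^sup>2 = 0\<close> with real coefficients, so the only
  models up to isomorphism are the real and the complex numbers, with \<open>conjg\<close> the usual conjugation.
\<close>

class real_or_complex = real_normed_field + banach +
  fixes conjg :: "'a \<Rightarrow> 'a" and re_part :: "'a \<Rightarrow> real"
  assumes conjg_add: "conjg (x + y) = conjg x + conjg y"
    and conjg_mult: "conjg (x * y) = conjg x * conjg y"
    and mult_conjg: "x * conjg x = (norm x)\<^sup>2 *\<^sub>R 1"
    and add_conjg: "x + conjg x = (2 * re_part x) *\<^sub>R 1"

instantiation real :: real_or_complex
begin
definition "conjg_real (x::real) = x"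
definition "re_part_real (x::real) = x"
instance
  by standard (auto simp: conjg_real_def re_part_real_def power2_eq_square)
end

instantiation complex :: real_or_complex
begin
definition "conjg_complex = cnj"
definition "re_part_complex = Re"
instance
  by standard
    (simp_all add: conjg_complex_def re_part_complex_def complex_eq_iff cmod_power2 power2_eq_square[of "Re _"] power2_eq_square[of "Im _"])
end

text \<open>
  A finite-dimensional Hilbert space over \<open>'k\<close> with scalar multiplication \<open>sc\<close> and inner product
  \<open>ip\<close>. The type classes carry the underlying real Hilbert space; the locale adds the
  \<open>'k\<close>-structure, compatible with the real one. (The inner product is linear in its
  second argument.)
\<close>

locale fd_hilbert = vector_space sc
  for sc :: "'k::real_or_complex \<Rightarrow> 'a::{real_inner, complete_space} \<Rightarrow> 'a" +
  fixes ip :: "'a \<Rightarrow> 'a \<Rightarrow> 'k"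
  assumes sc_of_real: "sc (of_real r) x = r *\<^sub>R x"
    and ip_add_right: "ip x (y + z) = ip x y + ip x z"
    and ip_sc_right: "ip x (sc c y) = c * ip x y"
    and ip_conjg: "ip y x = conjg (ip x y)"
    and ip_self: "ip x x = of_real ((norm x)\<^sup>2)"
    and finite_dim: "\<exists>A. finite A \<and> span A = UNIV"


section \<open>Sides\<close>

text \<open>\<open>seg p\<close> is \<open>H\<^sup>p\<close>, with coordinates numbered from 1; \<open>H\<close> itself is identified with \<open>seg 1\<close>.\<close>

definition seg :: "nat \<Rightarrow> (nat \<Rightarrow> 'a::zero) set" where
  "seg p = {v. \<forall>k. k \<notin> {1..p} \<longrightarrow> v k = 0}"

text \<open>\<open>half_line\<close> is \<open>\<ell>\<^sup>2(\<int>\<^sub><\<^sub>0; H)\<close>, its elements being extended by zero to all of \<open>\<int>\<close>.\<close>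

definition half_line :: "(int \<Rightarrow> 'a::real_normed_vector) set" where
  "half_line = {w. (\<forall>k\<ge>0. w k = 0) \<and> (\<lambda>k. (norm (w k))\<^sup>2) summable_on UNIV}"

definition seq_ip :: "('a \<Rightarrow> 'a \<Rightarrow> 'k::real_or_complex) \<Rightarrow> ('i \<Rightarrow> 'a) \<Rightarrow> ('i \<Rightarrow> 'a) \<Rightarrow> 'k" where
  "seq_ip ip x y = (\<Sum>\<^sub>\<infinity>k. ip (x k) (y k))"

text \<open>The identification of \<open>H\<^sup>p \<oplus> H\<^sup>p\<^sup>'\<close> with \<open>H\<^bsup>p+p'\<^esup>\<close>, and its inverse.\<close>

definition cat :: "nat \<Rightarrow> (nat \<Rightarrow> 'a) \<times> (nat \<Rightarrow> 'a) \<Rightarrow> (nat \<Rightarrow> 'a)" where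
  "cat p = (\<lambda>(u, u'). \<lambda>k. if k \<le> p then u k else u' (k - p))"

definition uncat :: "nat \<Rightarrow> (nat \<Rightarrow> 'a::zero) \<Rightarrow> (nat \<Rightarrow> 'a) \<times> (nat \<Rightarrow> 'a)" where
  "uncat p v = (\<lambda>k. if k \<le> p then v k else 0, \<lambda>k. if 1 \<le> k then v (k + p) else 0)"

text \<open>The unitary \<open>D\<^sup>L\<^sub>p\<close> and its adjoint; see \<open>DL_adj_DL\<close>, \<open>DL_DL_adj\<close> and \<open>DL_adjoint\<close> below.\<close>

definition DL :: "nat \<Rightarrow> (int \<Rightarrow> 'a::zero) \<times> (nat \<Rightarrow> 'a) \<Rightarrow> (int \<Rightarrow> 'a)" where
  "DL p = (\<lambda>(w, h). \<lambda>k.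
     if 0 \<le> k then 0 else if - int p \<le> k then h (nat (k + 1 + int p)) else w (k + int p))"

definition DL_adj :: "nat \<Rightarrow> (int \<Rightarrow> 'a::zero) \<Rightarrow> (int \<Rightarrow> 'a) \<times> (nat \<Rightarrow> 'a)" where
  "DL_adj p w = (\<lambda>k. if k < 0 then w (k - int p) else 0,
                 \<lambda>j. if j \<in> {1..p} then w (int j - 1 - int p) else 0)"


section \<open>Operators on carrier sets\<close>

text \<open>
  An operator on \<open>V\<close> is \<open>undefined\<close> outside \<open>V\<close>, so that operators which agree on \<open>V\<close> are equal.
\<close>

definition lin_ops :: "'x::ab_group_add set \<Rightarrow> ('k \<Rightarrow> 'x \<Rightarrow> 'x) \<Rightarrow> ('x \<Rightarrow> 'x) set" where
  "lin_ops V sc = {M \<in> V \<rightarrow>\<^sub>E V. (\<forall>x\<in>V. \<forall>y\<in>V. M (x + y) = M x + M y) \<and>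
                              (\<forall>c. \<forall>x\<in>V. M (sc c x) = sc c (M x))}"

definition self_adjoint_on :: "'x set \<Rightarrow> ('x \<Rightarrow> 'x \<Rightarrow> 'k) \<Rightarrow> ('x \<Rightarrow> 'x) \<Rightarrow> bool" where
  "self_adjoint_on V ip M \<longleftrightarrow> (\<forall>x\<in>V. \<forall>y\<in>V. ip (M x) y = ip x (M y))"

definition positive_definite_on ::
  "'x::zero set \<Rightarrow> ('x \<Rightarrow> 'x \<Rightarrow> 'k::real_or_complex) \<Rightarrow> ('x \<Rightarrow> 'x) \<Rightarrow> bool" where
  "positive_definite_on V ip M \<longleftrightarrow> (\<forall>x\<in>V. x \<noteq> 0 \<longrightarrow> 0 < re_part (ip x (M x)))"

definition bounded_on ::
  "'x set \<Rightarrow> ('x \<Rightarrow> 'x \<Rightarrow> 'k::real_or_complex) \<Rightarrow> ('x \<Rightarrow> 'x) \<Rightarrow> bool" where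
  "bounded_on V ip M \<longleftrightarrow>
     (\<exists>C. \<forall>x\<in>V. sqrt (re_part (ip (M x) (M x))) \<le> C * sqrt (re_part (ip x x)))"

definition coercive_on ::
  "'x::zero set \<Rightarrow> ('x \<Rightarrow> 'x \<Rightarrow> 'k::real_or_complex) \<Rightarrow> ('x \<Rightarrow> 'x) \<Rightarrow> bool" where
  "coercive_on V ip M \<longleftrightarrow>
     (\<exists>c>0. \<forall>x\<in>V. x \<noteq> 0 \<longrightarrow> c \<le> re_part (ip x (M x)) / re_part (ip x x))"

text \<open>Schur complement with respect to the second summand, of which \<open>V\<close> is the carrier.\<close>

definition schur ::
  "'y set \<Rightarrow> ('x::ab_group_add \<times> 'y::ab_group_add \<Rightarrow> 'x \<times> 'y) \<Rightarrow> 'x \<Rightarrow> 'x" where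
  "schur V M = (let M11 = (\<lambda>x. fst (M (x, 0))); M12 = (\<lambda>y. fst (M (0, y)));
                    M21 = (\<lambda>x. snd (M (x, 0))); M22 = (\<lambda>y. snd (M (0, y)))
                in (\<lambda>x. M11 x - M12 (inv_into V M22 (M21 x))))"


section \<open>Rectangles and West half-strips\<close>

text \<open>Vectors of a rectangle are tuples (South, North, West, East).\<close>

type_synonym ('a, 'b) rect_vec = "(nat \<Rightarrow> 'a) \<times> (nat \<Rightarrow> 'a) \<times> (nat \<Rightarrow> 'b) \<times> (nat \<Rightarrow> 'b)"

definition rect_space :: "nat \<Rightarrow> nat \<Rightarrow> ('a::zero, 'b::zero) rect_vec set" where
  "rect_space p q = seg p \<times> seg p \<times> seg q \<times> seg q"

definition rect_scale ::
  "('k \<Rightarrow> 'a \<Rightarrow> 'a) \<Rightarrow> ('k \<Rightarrow> 'b \<Rightarrow> 'b) \<Rightarrow> 'k \<Rightarrow> ('a, 'b) rect_vec \<Rightarrow> ('a, 'b) rect_vec" where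
  "rect_scale sc1 sc2 c = (\<lambda>(s, n, w, e). (sc1 c \<circ> s, sc1 c \<circ> n, sc2 c \<circ> w, sc2 c \<circ> e))"

definition rect_ip ::
  "('a \<Rightarrow> 'a \<Rightarrow> 'k::real_or_complex) \<Rightarrow> ('b \<Rightarrow> 'b \<Rightarrow> 'k) \<Rightarrow>
   ('a, 'b) rect_vec \<Rightarrow> ('a, 'b) rect_vec \<Rightarrow> 'k" where
  "rect_ip ip1 ip2 = (\<lambda>(s, n, w, e) (s', n', w', e').
     seq_ip ip1 s s' + seq_ip ip1 n n' + seq_ip ip2 w w' + seq_ip ip2 e e')"

definition rect_ops ::
  "('k::real_or_complex \<Rightarrow> 'a::real_inner \<Rightarrow> 'a) \<Rightarrow> ('a \<Rightarrow> 'a \<Rightarrow> 'k) \<Rightarrow>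
   ('k \<Rightarrow> 'b::real_inner \<Rightarrow> 'b) \<Rightarrow> ('b \<Rightarrow> 'b \<Rightarrow> 'k) \<Rightarrow>
   nat \<Rightarrow> nat \<Rightarrow> (('a, 'b) rect_vec \<Rightarrow> ('a, 'b) rect_vec) set" where
  "rect_ops sc1 ip1 sc2 ip2 p q =
     {M \<in> lin_ops (rect_space p q) (rect_scale sc1 sc2).
        self_adjoint_on (rect_space p q) (rect_ip ip1 ip2) M \<and>
        positive_definite_on (rect_space p q) (rect_ip ip1 ip2) M}"

abbreviation "face_operators sc1 ip1 sc2 ip2 \<equiv> rect_ops sc1 ip1 sc2 ip2 1 1"

text \<open>Vectors of a West half-strip are triples (South, North, East).\<close>

type_synonym ('a, 'b) half_vec = "(int \<Rightarrow> 'a) \<times> (int \<Rightarrow> 'a) \<times> (nat \<Rightarrow> 'b)"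

definition half_space :: "nat \<Rightarrow> ('a::real_normed_vector, 'b::zero) half_vec set" where
  "half_space q = half_line \<times> half_line \<times> seg q"

definition half_scale ::
  "('k \<Rightarrow> 'a \<Rightarrow> 'a) \<Rightarrow> ('k \<Rightarrow> 'b \<Rightarrow> 'b) \<Rightarrow> 'k \<Rightarrow> ('a, 'b) half_vec \<Rightarrow> ('a, 'b) half_vec" where
  "half_scale sc1 sc2 c = (\<lambda>(s, n, e). (sc1 c \<circ> s, sc1 c \<circ> n, sc2 c \<circ> e))"

definition half_ip ::
  "('a \<Rightarrow> 'a \<Rightarrow> 'k::real_or_complex) \<Rightarrow> ('b \<Rightarrow> 'b \<Rightarrow> 'k) \<Rightarrow>
   ('a, 'b) half_vec \<Rightarrow> ('a, 'b) half_vec \<Rightarrow> 'k" where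
  "half_ip ip1 ip2 = (\<lambda>(s, n, e) (s', n', e').
     seq_ip ip1 s s' + seq_ip ip1 n n' + seq_ip ip2 e e')"

definition half_ops ::
  "('k::real_or_complex \<Rightarrow> 'a::real_inner \<Rightarrow> 'a) \<Rightarrow> ('a \<Rightarrow> 'a \<Rightarrow> 'k) \<Rightarrow>
   ('k \<Rightarrow> 'b::real_inner \<Rightarrow> 'b) \<Rightarrow> ('b \<Rightarrow> 'b \<Rightarrow> 'k) \<Rightarrow>
   nat \<Rightarrow> (('a, 'b) half_vec \<Rightarrow> ('a, 'b) half_vec) set" where
  "half_ops sc1 ip1 sc2 ip2 q =
     {M \<in> lin_ops (half_space q) (half_scale sc1 sc2).
        bounded_on (half_space q) (half_ip ip1 ip2) M \<and>
        self_adjoint_on (half_space q) (half_ip ip1 ip2) M \<and>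
        coercive_on (half_space q) (half_ip ip1 ip2) M}"


section \<open>Gluing\<close>

text \<open>
  For each gluing, the first definition is the operator of the sum of the two quadratic forms; its
  argument is the pair of the outer variables and of the common variable \<open>v\<close> of the shared side.
\<close>

text \<open>\<open>M\<close> (width \<open>p\<close>) West of \<open>M'\<close> (width \<open>p'\<close>), both of height \<open>q\<close>.\<close>

definition rect_hsum where
  "rect_hsum M M' = (\<lambda>(((s, s'), (n, n'), w, e), v).
     let (Ms, Mn, Mw, Me) = M (s, n, w, v);
         (Ms', Mn', Mw', Me') = M' (s', n', v, e)
     in (((Ms, Ms'), (Mn, Mn'), Mw, Me'), Me + Mw'))"

definition rect_hglue ::
  "nat \<Rightarrow> nat \<Rightarrow> nat \<Rightarrow> (('a::ab_group_add, 'b::ab_group_add) rect_vec \<Rightarrow> ('a, 'b) rect_vec) \<Rightarrow>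
   (('a, 'b) rect_vec \<Rightarrow> ('a, 'b) rect_vec) \<Rightarrow> ('a, 'b) rect_vec \<Rightarrow> ('a, 'b) rect_vec" where
  "rect_hglue p p' q M M' = restrict (\<lambda>(s, n, w, e).
     let (ys, yn, yw, ye) = schur (seg q) (rect_hsum M M') (uncat p s, uncat p n, w, e)
     in (cat p ys, cat p yn, yw, ye)) (rect_space (p + p') q)"

text \<open>\<open>M\<close> (height \<open>q\<close>) South of \<open>M'\<close> (height \<open>q'\<close>), both of width \<open>p\<close>.\<close>

definition rect_vsum where
  "rect_vsum M M' = (\<lambda>((s, n, (w, w'), (e, e')), v).
     let (Ms, Mn, Mw, Me) = M (s, v, w, e);
         (Ms', Mn', Mw', Me') = M' (v, n, w', e')
     in ((Ms, Mn', (Mw, Mw'), (Me, Me')), Mn + Ms'))"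

definition rect_vglue ::
  "nat \<Rightarrow> nat \<Rightarrow> nat \<Rightarrow> (('a::ab_group_add, 'b::ab_group_add) rect_vec \<Rightarrow> ('a, 'b) rect_vec) \<Rightarrow>
   (('a, 'b) rect_vec \<Rightarrow> ('a, 'b) rect_vec) \<Rightarrow> ('a, 'b) rect_vec \<Rightarrow> ('a, 'b) rect_vec" where
  "rect_vglue p q q' M M' = restrict (\<lambda>(s, n, w, e).
     let (ys, yn, yw, ye) = schur (seg p) (rect_vsum M M') (s, n, uncat q w, uncat q e)
     in (ys, yn, cat q yw, cat q ye)) (rect_space p (q + q'))"

text \<open>Half-strip \<open>M\<close> (height \<open>q\<close>) South of the half-strip \<open>M'\<close> (height \<open>q'\<close>).\<close>

definition half_vsum where
  "half_vsum M M' = (\<lambda>((s, n, (e, e')), v).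
     let (Ms, Mn, Me) = M (s, v, e);
         (Ms', Mn', Me') = M' (v, n, e')
     in ((Ms, Mn', (Me, Me')), Mn + Ms'))"

definition half_vglue ::
  "nat \<Rightarrow> nat \<Rightarrow> (('a::real_normed_vector, 'b::ab_group_add) half_vec \<Rightarrow> ('a, 'b) half_vec) \<Rightarrow>
   (('a, 'b) half_vec \<Rightarrow> ('a, 'b) half_vec) \<Rightarrow> ('a, 'b) half_vec \<Rightarrow> ('a, 'b) half_vec" where
  "half_vglue q q' M M' = restrict (\<lambda>(s, n, e).
     let (ys, yn, ye) = schur half_line (half_vsum M M') (s, n, uncat q e)
     in (ys, yn, cat q ye)) (half_space (q + q'))"

text \<open>\<open>half_hglue p q M P\<close> is \<open>M|P\<close>: the half-strip \<open>M\<close> West of the \<open>p \<times> q\<close> rectangle \<open>P\<close>.\<close>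

definition half_hsum where
  "half_hsum M P = (\<lambda>(((s, s'), (n, n'), e), v).
     let (Ms, Mn, Me) = M (s, n, v);
         (Ps, Pn, Pw, Pe) = P (s', n', v, e)
     in (((Ms, Ps), (Mn, Pn), Pe), Me + Pw))"

definition half_hglue ::
  "nat \<Rightarrow> nat \<Rightarrow> (('a::real_normed_vector, 'b::ab_group_add) half_vec \<Rightarrow> ('a, 'b) half_vec) \<Rightarrow>
   (('a, 'b) rect_vec \<Rightarrow> ('a, 'b) rect_vec) \<Rightarrow> ('a, 'b) half_vec \<Rightarrow> ('a, 'b) half_vec" where
  "half_hglue p q M P = restrict (\<lambda>(s, n, e).
     let (ys, yn, ye) = schur (seg q) (half_hsum M P) (DL_adj p s, DL_adj p n, e)
     in (DL p ys, DL p yn, ye)) (half_space q)"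

text \<open>
  \<open>Q\<^bsup>[p,1]\<^esup>\<close>, \<open>Q\<^bsup>[p,q]\<^esup>\<close> (rows glued from left to right, then stacked from bottom to top) and the
  stack of \<open>q\<close> copies of a half-strip; they are meant for \<open>p, q \<ge> 1\<close> only.
\<close>

primrec row where
  "row Q 0 = undefined"
| "row Q (Suc p) = (if p = 0 then Q else rect_hglue p 1 1 (row Q p) Q)"

primrec grid where
  "grid Q p 0 = undefined"
| "grid Q p (Suc q) = (if q = 0 then row Q p else rect_vglue p q 1 (grid Q p q) (row Q p))"

primrec half_stack where
  "half_stack B 0 = undefined"
| "half_stack B (Suc q) = (if q = 0 then B else half_vglue q 1 (half_stack B q) B)"

definition west_fixed_point_id ::
  "('k::real_or_complex \<Rightarrow> 'a::real_inner \<Rightarrow> 'a) \<Rightarrow> ('a \<Rightarrow> 'a \<Rightarrow> 'k) \<Rightarrow>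
   ('k \<Rightarrow> 'b::real_inner \<Rightarrow> 'b) \<Rightarrow> ('b \<Rightarrow> 'b \<Rightarrow> 'k) \<Rightarrow>
   (('a, 'b) rect_vec \<Rightarrow> ('a, 'b) rect_vec) \<Rightarrow> (('a, 'b) half_vec \<Rightarrow> ('a, 'b) half_vec) \<Rightarrow> bool" where
  "west_fixed_point_id sc1 ip1 sc2 ip2 Q B \<longleftrightarrow>
     B \<in> half_ops sc1 ip1 sc2 ip2 1 \<and>
     (\<forall>p\<ge>1. \<forall>q\<ge>1.
        half_hglue p q (half_stack B q) (grid Q p q) = half_stack B q \<and>
        (\<forall>r\<ge>1. \<forall>P \<in> rect_ops sc1 ip1 sc2 ip2 r q.
           half_hglue r q (half_hglue p q (half_stack B q) (grid Q p q)) P =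
           half_hglue r q (half_stack B q) P))"


section \<open>Blocks\<close>

datatype h_side = South | North
datatype v_side = West | East

text \<open>Coordinates and inclusions of the sides; those of South and North serve both shapes.\<close>

definition h_proj :: "h_side \<Rightarrow> 'u \<times> 'u \<times> 'r \<Rightarrow> 'u" where
  "h_proj a = (\<lambda>(s, n, _). case a of South \<Rightarrow> s | North \<Rightarrow> n)"

definition h_inj :: "h_side \<Rightarrow> 'u \<Rightarrow> 'u::zero \<times> 'u \<times> 'r::zero" where
  "h_inj a x = (case a of South \<Rightarrow> (x, 0, 0) | North \<Rightarrow> (0, x, 0))"

definition v_proj :: "v_side \<Rightarrow> 'u \<times> 'u \<times> 'v \<times> 'v \<Rightarrow> 'v" where
  "v_proj a = (\<lambda>(_, _, w, e). case a of West \<Rightarrow> w | East \<Rightarrow> e)"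

definition v_inj :: "v_side \<Rightarrow> 'v \<Rightarrow> 'u::zero \<times> 'u \<times> 'v::zero \<times> 'v" where
  "v_inj a x = (case a of West \<Rightarrow> (0, 0, x, 0) | East \<Rightarrow> (0, 0, 0, x))"

definition e_proj :: "'u \<times> 'u \<times> 'v \<Rightarrow> 'v" where
  "e_proj = (\<lambda>(_, _, e). e)"

definition e_inj :: "'v \<Rightarrow> 'u::zero \<times> 'u \<times> 'v" where
  "e_inj x = (0, 0, x)"

text \<open>
  The block \<open>M\<^sub>a\<^sub>b\<close>, mapping side \<open>b\<close> to side \<open>a\<close>. In the names, \<open>h\<close> stands for South or North, \<open>v\<close> for
  West or East of a rectangle, \<open>e\<close> for East of a half-strip.
\<close>

definition blk_hh where "blk_hh M a b x = h_proj a (M (h_inj b x))"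
definition blk_hv where "blk_hv M a b x = h_proj a (M (v_inj b x))"
definition blk_vh where "blk_vh M a b x = v_proj a (M (h_inj b x))"
definition blk_vv where "blk_vv M a b x = v_proj a (M (v_inj b x))"
definition blk_he where "blk_he M a x = h_proj a (M (e_inj x))"
definition blk_eh where "blk_eh M b x = e_proj (M (h_inj b x))"
definition blk_ee where "blk_ee M x = e_proj (M (e_inj x))"


section \<open>The shift is unitary\<close>

lemma half_line_uminus_shift:
  assumes "w \<in> half_line"
  shows "(\<lambda>k. if k < 0 then w (k - int p) else 0) \<in> half_line"
proof -
  have "(\<lambda>k. (norm (w k))\<^sup>2) summable_on range (\<lambda>k. k - int p)"
    using assms summable_on_subset_banach unfolding half_line_def by blast
  then have "(\<lambda>k. (norm (w (k - int p)))\<^sup>2) summable_on UNIV"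
    by (subst (asm) summable_on_reindex) (auto simp: o_def inj_on_def)
  then have "(\<lambda>k. (norm (w (k - int p)))\<^sup>2) summable_on {..<0}"
    using summable_on_subset_banach by blast
  then have "(\<lambda>k. (norm (if k < 0 then w (k - int p) else 0))\<^sup>2) summable_on UNIV"
    by (rule summable_on_cong_neutral[THEN iffD1, rotated -1]) auto
  then show ?thesis by (auto simp: half_line_def)
qed

lemma DL_adj_mem: "w \<in> half_line \<Longrightarrow> DL_adj p w \<in> half_line \<times> seg p"
  using half_line_uminus_shift[of w p] by (auto simp: DL_adj_def seg_def)

lemma DL_mem:
  assumes "w \<in> half_line" and "h \<in> seg p"
  shows "DL p (w, h) \<in> half_line"
proof -
  have "(\<lambda>k. (norm (w k))\<^sup>2) summable_on (\<lambda>k. k + int p) ` {..< - int p}"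
    using assms summable_on_subset_banach unfolding half_line_def by blast
  then have "(\<lambda>k. (norm (w (k + int p)))\<^sup>2) summable_on {..< - int p}"
    by (subst (asm) summable_on_reindex) (auto simp: o_def inj_on_def)
  then have "(\<lambda>k. (norm (DL p (w, h) k))\<^sup>2) summable_on {..< - int p}"
    by (rule summable_on_cong[THEN iffD1, rotated]) (auto simp: DL_def)
  then have "(\<lambda>k. (norm (DL p (w, h) k))\<^sup>2) summable_on ({..< - int p} \<union> {- int p..<0})"
    by (rule summable_on_Un_disjoint) auto
  then have "(\<lambda>k. (norm (DL p (w, h) k))\<^sup>2) summable_on UNIV"
    by (rule summable_on_cong_neutral[THEN iffD1, rotated -1]) (auto simp: DL_def)
  then show ?thesis by (auto simp: half_line_def DL_def)
qed

lemma DL_DL_adj: "w \<in> half_line \<Longrightarrow> DL p (DL_adj p w) = w"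
  by (auto simp: DL_def DL_adj_def half_line_def fun_eq_iff)

lemma DL_adj_DL: "w \<in> half_line \<Longrightarrow> h \<in> seg p \<Longrightarrow> DL_adj p (DL p (w, h)) = (w, h)"
  by (auto simp: DL_def DL_adj_def half_line_def seg_def fun_eq_iff)

lemma conjg_of_real [simp]: "conjg (of_real r :: 'k::real_or_complex) = of_real r"
proof (cases "r = 0")
  case True
  have "conjg (0 + 0 :: 'k) = conjg 0 + conjg 0" by (rule conjg_add)
  with True show ?thesis by simp
next
  case False
  have "of_real r * conjg (of_real r :: 'k) = of_real r * of_real r"
    by (simp add: mult_conjg power2_eq_square of_real_def)
  with False show ?thesis by simp
qed

lemma norm_conjg [simp]: "norm (conjg z :: 'k::real_or_complex) = norm z"
proof (cases "z = 0")
  case True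
  then show ?thesis using conjg_of_real[of 0, where 'k = 'k] by simp
next
  case False
  have "norm z * norm (conjg z) = norm z * norm z"
    using arg_cong[OF mult_conjg[of z], of norm] by (simp add: norm_mult power2_eq_square)
  with False show ?thesis by simp
qed

context fd_hilbert
begin

lemma norm_sc: "norm (sc c x) = norm c * norm x"
proof -
  have "ip (sc c x) (sc c x) = c * conjg (c * ip x x)"
    by (metis ip_sc_right ip_conjg)
  also have "\<dots> = c * conjg c * of_real ((norm x)\<^sup>2)"
    by (metis conjg_mult mult.assoc ip_self conjg_of_real)
  also have "\<dots> = of_real ((norm c)\<^sup>2 * (norm x)\<^sup>2)"
    by (simp add: mult_conjg scaleR_conv_of_real)
  finally have "(norm (sc c x))\<^sup>2 = (norm c * norm x)\<^sup>2"
    by (simp only: ip_self of_real_eq_iff power_mult_distrib)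
  then show ?thesis by simp
qed

lemma ip_add_conjg: "ip x y + conjg (ip x y) = of_real (2 * (x \<bullet> y))"
proof -
  have add_left: "ip (u + v) z = ip u z + ip v z" for u v z
    by (metis ip_conjg ip_add_right conjg_add)
  have "of_real ((norm (x + y))\<^sup>2) = ip x x + ip y y + (ip x y + conjg (ip x y))"
    unfolding ip_self[symmetric] add_left ip_add_right ip_conjg[of y x] by simp
  also have "(norm (x + y))\<^sup>2 = (norm x)\<^sup>2 + (norm y)\<^sup>2 + 2 * (x \<bullet> y)"
    by (simp add: power2_norm_eq_inner inner_add_left inner_add_right inner_commute)
  finally show ?thesis by (simp add: ip_self)
qed

lemma re_part_ip: "re_part (ip x y) = x \<bullet> y"
proof -
  have "of_real (2 * re_part (ip x y)) = (of_real (2 * (x \<bullet> y)) :: 'k)"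
    using ip_add_conjg[of x y] add_conjg[of "ip x y"] by (simp only: scaleR_conv_of_real mult_1_right)
  then show ?thesis by (simp only: of_real_eq_iff)
qed

lemma norm_ip_le: "norm (ip x y) \<le> norm x * norm y"
proof (cases "ip x y = 0")
  case False
  define z where "z = ip x y"
  have "ip x (sc (conjg z) y) = of_real ((norm z)\<^sup>2)"
    using mult_conjg[of z] by (simp add: ip_sc_right z_def mult.commute scaleR_conv_of_real)
  then have "of_real (2 * (x \<bullet> sc (conjg z) y)) = (of_real (2 * (norm z)\<^sup>2) :: 'k)"
    using ip_add_conjg[of x "sc (conjg z) y"] by (simp only: conjg_of_real flip: of_real_add) simp
  then have "(norm z)\<^sup>2 = x \<bullet> sc (conjg z) y"
    by (simp only: of_real_eq_iff)
  also have "\<dots> \<le> norm x * (norm z * norm y)"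
    using norm_cauchy_schwarz[of x "sc (conjg z) y"] by (simp add: norm_sc)
  finally have "norm z * norm z \<le> norm z * (norm x * norm y)"
    by (simp only: power2_eq_square mult.left_commute)
  moreover have "0 < norm z"
    using False by (simp only: z_def zero_less_norm_iff not_False_eq_True)
  ultimately show ?thesis
    unfolding z_def by (rule mult_left_le_imp_le)
next
  case True
  then show ?thesis by (simp only: norm_zero mult_nonneg_nonneg norm_ge_zero)
qed

lemma summable_ip:
  assumes "v \<in> half_line" and "w \<in> half_line"
  shows "(\<lambda>k. ip (v k) (w k)) summable_on A"
proof -
  have "(\<lambda>k. (norm (v k))\<^sup>2 + (norm (w k))\<^sup>2) summable_on UNIV"
    using assms by (intro summable_on_add) (auto simp: half_line_def)
  then have 1: "(\<lambda>k. (norm (v k))\<^sup>2 + (norm (w k))\<^sup>2) summable_on A"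
    by (rule summable_on_subset_banach) simp
  have 2: "norm (ip (v k) (w k)) \<le> (norm (v k))\<^sup>2 + (norm (w k))\<^sup>2" for k
    using norm_ip_le[of "v k" "w k"] sum_squares_bound[of "norm (v k)" "norm (w k)"]
      mult_nonneg_nonneg[OF norm_ge_zero[of "v k"] norm_ge_zero[of "w k"]] by linarith
  have "(\<lambda>k. norm (ip (v k) (w k))) summable_on A"
    by (rule Infinite_Sum.abs_summable_on_comparison_test'[OF 1 2])
  then show ?thesis by (rule abs_summable_summable)
qed

lemma ip_zero [simp]: "ip x 0 = 0" "ip 0 x = 0"
  using norm_ip_le[of x 0] norm_ip_le[of 0 x] by auto

lemma DL_adjoint:
  assumes "w \<in> half_line" and "h \<in> seg p" and "v \<in> half_line"
  shows "seq_ip ip (DL p (w, h)) v =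
         seq_ip ip w (fst (DL_adj p v)) + seq_ip ip h (snd (DL_adj p v))"
proof -
  let ?f = "\<lambda>k. ip (DL p (w, h) k) (v k)"
  have summ: "?f summable_on A" for A
    using assms by (intro summable_ip DL_mem) auto
  have "seq_ip ip (DL p (w, h)) v = infsum ?f ({..< - int p} \<union> {- int p..<0})"
    unfolding seq_ip_def by (rule infsum_cong_neutral) (auto simp: DL_def)
  also have "\<dots> = infsum ?f {..< - int p} + infsum ?f {- int p..<0}"
    by (rule infsum_Un_disjoint) (auto intro: summ)
  also have "infsum ?f {..< - int p} = seq_ip ip w (fst (DL_adj p v))"
  proof -
    have eq: "{..< - int p} = (\<lambda>k. k - int p) ` {..<0}"
      by (auto simp: image_iff intro!: bexI[of _ "_ + int p"])
    have "infsum ?f {..< - int p} = infsum (\<lambda>k. ?f (k - int p)) {..<0}"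
      unfolding eq by (subst infsum_reindex) (auto simp: o_def inj_on_def)
    also have "\<dots> = seq_ip ip w (fst (DL_adj p v))"
      unfolding seq_ip_def by (rule infsum_cong_neutral) (auto simp: DL_def DL_adj_def)
    finally show ?thesis .
  qed
  also have "infsum ?f {- int p..<0} = seq_ip ip h (snd (DL_adj p v))"
  proof -
    have eq: "{- int p..<0} = (\<lambda>j. int j - 1 - int p) ` {1..p}"
    proof (intro set_eqI iffI)
      fix k assume "k \<in> {- int p..<0}"
      then show "k \<in> (\<lambda>j. int j - 1 - int p) ` {1..p}"
        by (intro image_eqI[of _ _ "nat (k + 1 + int p)"]) auto
    qed auto
    have "infsum ?f {- int p..<0} = infsum (\<lambda>j. ?f (int j - 1 - int p)) {1..p}"
      unfolding eq by (subst infsum_reindex) (auto simp: o_def inj_on_def)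
    also have "\<dots> = seq_ip ip h (snd (DL_adj p v))"
      unfolding seq_ip_def by (rule infsum_cong_neutral) (auto simp: DL_def DL_adj_def)
    finally show ?thesis .
  qed
  finally show ?thesis .
qed

end

end

theory Submission
  imports Defs
begin

text \<open>
  A gluing maps \<open>x\<close> to \<open>y\<close> iff for some value \<open>v\<close> of the common variable the summed operator maps
  \<open>(x, v)\<close> to \<open>(y, 0)\<close>. In this form gluings are associative and satisfy the interchange law, as soon
  as every Schur complement involved inverts an invertible operator. Invertibility follows from
  Lax--Milgram, since boundedness and coercivity survive sums and Schur complements. Hence the fixed
  point equations for all \<open>p, q\<close> follow from the one for \<open>p = q = 1\<close>. The latter is the system of block
  equations; its remaining blocks, from South and North to East, are determined by self-adjointness.
  The second clause in the definition of a fixed point is implied by the first.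
\<close>

subsection \<open>Square-summable families\<close>

text \<open>Stacking half-strips eliminates a variable in the infinite-dimensional
  \<open>half_line\<close>, where positive definiteness alone does not give an inverse. Hence
  explicit upper and lower constants are carried through sums, Schur complements and changes of
  coordinates. Face operators come with no such constants; these are extracted from finite
  dimension. All of this takes place in the real Hilbert space obtained by forgetting the
  \<open>'k\<close>-structure: \<open>rip\<close> is the real part of the \<open>'k\<close>-valued
  inner product, self-adjointness becomes symmetry for \<open>rip\<close>, and neither gluing nor
  equality of operators mentions scalars. The class supplies \<open>rip\<close> for families and,
  recursively, for products, so that each nested product of sides gets its structure from its type.
  The types also contain families that are not square-summable, where the infinite sum in
  \<open>rip\<close> may be just its default value 0; bilinearity and definiteness are therefore
  required on \<open>sqs\<close> only, while nonnegativity survives everywhere.\<close>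

class ell2 = ab_group_add +
  fixes rscale :: "real \<Rightarrow> 'a \<Rightarrow> 'a" and rip :: "'a \<Rightarrow> 'a \<Rightarrow> real" and sqs :: "'a set"
  assumes rscale_add_right: "rscale r (x + y) = rscale r x + rscale r y"
    and rscale_add_left: "rscale (r + t) x = rscale r x + rscale t x"
    and rscale_rscale: "rscale r (rscale t x) = rscale (r * t) x"
    and rscale_one: "rscale 1 x = x"
    and rip_nonneg [simp]: "0 \<le> rip x x"
    and rip_commute: "rip x y = rip y x"
    and rip_minus_minus [simp]: "rip (- x) (- y) = rip x y"
    and sqs_zero: "0 \<in> sqs"
    and sqs_add: "x \<in> sqs \<Longrightarrow> y \<in> sqs \<Longrightarrow> x + y \<in> sqs"
    and sqs_rscale: "x \<in> sqs \<Longrightarrow> rscale r x \<in> sqs"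
    and rip_add_right: "x \<in> sqs \<Longrightarrow> y \<in> sqs \<Longrightarrow> z \<in> sqs \<Longrightarrow> rip x (y + z) = rip x y + rip x z"
    and rip_rscale_right: "x \<in> sqs \<Longrightarrow> y \<in> sqs \<Longrightarrow> rip x (rscale r y) = r * rip x y"
    and rip_eq_0_imp: "x \<in> sqs \<Longrightarrow> rip x x = 0 \<Longrightarrow> x = 0"
begin

lemma rscale_zero_left [simp]: "rscale 0 x = 0"
  using rscale_add_left[of 0 0 x] by simp

lemma rscale_zero_right [simp]: "rscale r 0 = 0"
  using rscale_rscale[of r 0 0] by simp

lemma rscale_minus_one: "rscale (- 1) x = - x"
  using rscale_add_left[of "- 1" 1 x] by (simp add: rscale_one eq_neg_iff_add_eq_0)

lemma rip_add_left:
  "x \<in> sqs \<Longrightarrow> y \<in> sqs \<Longrightarrow> z \<in> sqs \<Longrightarrow> rip (x + y) z = rip x z + rip y z"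
  by (simp add: rip_commute[of _ z] rip_add_right)

lemma rip_rscale_left: "x \<in> sqs \<Longrightarrow> y \<in> sqs \<Longrightarrow> rip (rscale r x) y = r * rip x y"
  by (simp add: rip_commute[of _ y] rip_rscale_right)

lemma sqs_diff: "x \<in> sqs \<Longrightarrow> y \<in> sqs \<Longrightarrow> x - y \<in> sqs"
  using sqs_add[of x "rscale (- 1) y"] sqs_rscale[of y "- 1"] by (simp add: rscale_minus_one)

lemma rip_zero_right [simp]: "x \<in> sqs \<Longrightarrow> rip x 0 = 0"
  using rip_rscale_right[of x 0 0] sqs_zero by simp

lemma rip_zero_left [simp]: "x \<in> sqs \<Longrightarrow> rip 0 x = 0"
  by (simp add: rip_commute[of 0])

lemma rip_zero_zero [simp]: "rip 0 0 = 0"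
  by (simp add: sqs_zero)

lemma rip_diff_right: "x \<in> sqs \<Longrightarrow> y \<in> sqs \<Longrightarrow> z \<in> sqs \<Longrightarrow> rip x (y - z) = rip x y - rip x z"
  using rip_add_right[of x "y - z" z] by (simp add: sqs_diff)

lemma rip_diff_left: "x \<in> sqs \<Longrightarrow> y \<in> sqs \<Longrightarrow> z \<in> sqs \<Longrightarrow> rip (x - y) z = rip x z - rip y z"
  by (simp add: rip_commute[of _ z] rip_diff_right)

text \<open>Testing on \<open>x\<close> and \<open>y\<close> suffices because \<open>x - y\<close>
  is a combination of them; hence the premise may be checked inside any set that contains
  both.\<close>

lemma rip_eq_rightD:
  assumes "x \<in> sqs" "y \<in> sqs" "\<And>z. z \<in> {x, y} \<Longrightarrow> rip x z = rip y z"
  shows "x = y"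
proof -
  have "rip (x - y) (x - y) = 0"
    using assms(1,2) assms(3)[of x] assms(3)[of y] by (simp add: rip_diff_left rip_diff_right sqs_diff)
  then show ?thesis
    using rip_eq_0_imp[of "x - y"] sqs_diff assms by simp
qed

lemma rip_cauchy_schwarz:
  assumes x: "x \<in> sqs" and y: "y \<in> sqs"
  shows "(rip x y)\<^sup>2 \<le> rip x x * rip y y"
proof (cases "y = 0")
  case True
  then show ?thesis using x by simp
next
  case False
  then have pos: "rip y y > 0"
    using rip_eq_0_imp[OF y] rip_nonneg[of y] by linarith
  define t where "t = rip x y / rip y y"
  define z where "z = x - rscale t y"
  have "0 \<le> rip z z" by simp
  also have "rip z z = rip x x - 2 * t * rip x y + t * t * rip y y"
    using x y by (simp add: z_def rip_diff_left rip_diff_right sqs_diff sqs_rscale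
        rip_rscale_left rip_rscale_right rip_commute[of y x] algebra_simps)
  also have "\<dots> = rip x x - (rip x y)\<^sup>2 / rip y y"
    using pos by (simp add: t_def field_simps power2_eq_square)
  finally show ?thesis
    using pos by (simp add: field_simps)
qed

text \<open>This is a metric only on subsets of \<open>sqs\<close>. Completeness and the Banach
  fixed point theorem are therefore taken from the set-based locale \<open>Metric_space\<close> and
  not from a type class.\<close>

definition rdist where "rdist x y = sqrt (rip (x - y) (x - y))"

lemma rdist_triangle:
  assumes "x \<in> sqs" "y \<in> sqs" "z \<in> sqs"
  shows "rdist x z \<le> rdist x y + rdist y z"
proof -
  define u v where "u = x - y" and "v = y - z"
  have uv: "u \<in> sqs" "v \<in> sqs" "x - z = u + v"
    using assms by (simp_all add: u_def v_def sqs_diff algebra_simps)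
  have "rip u v \<le> sqrt (rip u u * rip v v)"
    using rip_cauchy_schwarz[OF uv(1,2)] by (simp add: real_le_rsqrt)
  then have "rip (u + v) (u + v) \<le> (sqrt (rip u u) + sqrt (rip v v))\<^sup>2"
    using uv by (simp add: rip_add_left rip_add_right sqs_add rip_commute[of v u] real_sqrt_mult power2_sum)
  then show ?thesis
    unfolding rdist_def uv(3) by (auto simp: u_def v_def intro: real_le_lsqrt)
qed

lemma Metric_space_rdist:
  assumes "X \<subseteq> sqs"
  shows "Metric_space X rdist"
proof
  show "rdist x y = 0 \<longleftrightarrow> x = y" if "x \<in> X" "y \<in> X" for x y
  proof -
    have "x - y \<in> sqs" using that assms sqs_diff by blast
    then show ?thesis
      using rip_eq_0_imp[of "x - y"] sqs_zero by (auto simp: rdist_def)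
  qed
  show "rdist x y = rdist y x" for x y
    using rip_minus_minus[of "x - y" "x - y"] by (simp add: rdist_def)
  show "rdist x z \<le> rdist x y + rdist y z" if "x \<in> X" "y \<in> X" "z \<in> X" for x y z
    using that assms by (intro rdist_triangle) auto
qed (simp add: rdist_def)

definition subspace_sqs :: "'a set \<Rightarrow> bool" where
  "subspace_sqs X \<longleftrightarrow> X \<subseteq> sqs \<and> 0 \<in> X \<and> (\<forall>x\<in>X. \<forall>y\<in>X. x + y \<in> X) \<and> (\<forall>r. \<forall>x\<in>X. rscale r x \<in> X)"

lemma subspace_sqs_diff: "subspace_sqs X \<Longrightarrow> x \<in> X \<Longrightarrow> y \<in> X \<Longrightarrow> x - y \<in> X"
  unfolding subspace_sqs_def by (metis rscale_minus_one add_uminus_conv_diff)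

definition complete_sqs :: "'a set \<Rightarrow> bool" where
  "complete_sqs X \<longleftrightarrow> subspace_sqs X \<and> Metric_space.mcomplete X rdist"

end

instantiation "fun" :: (type, real_inner) ell2
begin

definition "rscale_fun r (f :: 'a \<Rightarrow> 'b) = (\<lambda>k. r *\<^sub>R f k)"
definition "rip_fun (f :: 'a \<Rightarrow> 'b) g = (\<Sum>\<^sub>\<infinity>k. f k \<bullet> g k)"
definition "sqs_fun = {f :: 'a \<Rightarrow> 'b. (\<lambda>k. (norm (f k))\<^sup>2) summable_on UNIV}"

lemma summable_on_inner:
  fixes f g :: "'a \<Rightarrow> 'b"
  assumes "f \<in> sqs" "g \<in> sqs"
  shows "(\<lambda>k. f k \<bullet> g k) summable_on UNIV"
proof -
  have sum: "(\<lambda>k. (norm (f k))\<^sup>2 + (norm (g k))\<^sup>2) summable_on UNIV"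
    using assms by (intro summable_on_add) (auto simp: sqs_fun_def)
  have "norm (f k \<bullet> g k) \<le> (norm (f k))\<^sup>2 + (norm (g k))\<^sup>2" for k
    using Cauchy_Schwarz_ineq2[of "f k" "g k"] sum_squares_bound[of "norm (f k)" "norm (g k)"]
      mult_nonneg_nonneg[OF norm_ge_zero[of "f k"] norm_ge_zero[of "g k"]]
    unfolding real_norm_def by linarith
  then have "(\<lambda>k. norm (f k \<bullet> g k)) summable_on UNIV"
    by (rule Infinite_Sum.abs_summable_on_comparison_test'[OF sum])
  then show ?thesis by (rule abs_summable_summable)
qed

instance
proof
  fix x y z :: "'a \<Rightarrow> 'b" and r t :: real
  show "0 \<le> rip x x"
    by (simp add: rip_fun_def infsum_nonneg)
  show "0 \<in> (sqs :: ('a \<Rightarrow> 'b) set)"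
    by (simp add: sqs_fun_def)
  show "x + y \<in> sqs" if "x \<in> sqs" "y \<in> sqs"
  proof -
    have sum: "(\<lambda>k. 2 * (norm (x k))\<^sup>2 + 2 * (norm (y k))\<^sup>2) summable_on UNIV"
      using that by (intro summable_on_add summable_on_cmult_right) (auto simp: sqs_fun_def)
    have "norm ((norm ((x + y) k))\<^sup>2) \<le> 2 * (norm (x k))\<^sup>2 + 2 * (norm (y k))\<^sup>2" for k
    proof -
      have "(norm (x k + y k))\<^sup>2 \<le> (norm (x k) + norm (y k))\<^sup>2"
        by (intro power_mono norm_triangle_ineq) simp
      then show ?thesis
        using sum_squares_bound[of "norm (x k)" "norm (y k)"] by (simp add: power2_sum)
    qed
    then show ?thesis
      using Infinite_Sum.abs_summable_on_comparison_test'[OF sum, of "\<lambda>k. (norm ((x + y) k))\<^sup>2"]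
      by (simp add: sqs_fun_def)
  qed
  show "rscale r x \<in> sqs" if "x \<in> sqs"
    using that summable_on_cmult_right[of "\<lambda>k. (norm (x k))\<^sup>2" UNIV "r\<^sup>2"]
    by (simp add: sqs_fun_def rscale_fun_def power_mult_distrib)
  show "rip x (y + z) = rip x y + rip x z" if "x \<in> sqs" "y \<in> sqs" "z \<in> sqs"
    using that by (simp add: rip_fun_def inner_add_right infsum_add summable_on_inner)
  show "rip x (rscale r y) = r * rip x y" if "x \<in> sqs" "y \<in> sqs"
    using that by (simp add: rip_fun_def rscale_fun_def infsum_cmult_right summable_on_inner)
  show "x = 0" if "x \<in> sqs" "rip x x = 0"
  proof
    fix k
    have "x k \<bullet> x k \<le> (\<Sum>\<^sub>\<infinity>k. x k \<bullet> x k)"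
      using finite_sum_le_infsum[OF summable_on_inner[OF that(1,1)], of "{k}"] by simp
    then show "x k = 0 k"
      by (metis that(2) rip_fun_def inner_eq_zero_iff inner_ge_zero order_antisym zero_fun_apply)
  qed
qed (auto simp: rscale_fun_def rip_fun_def fun_eq_iff scaleR_add_right scaleR_add_left inner_commute)

end

instantiation prod :: (ell2, ell2) ell2
begin

definition "rscale_prod r (x :: 'a \<times> 'b) = (rscale r (fst x), rscale r (snd x))"
definition "rip_prod (x :: 'a \<times> 'b) y = rip (fst x) (fst y) + rip (snd x) (snd y)"
definition "sqs_prod = (sqs \<times> sqs :: ('a \<times> 'b) set)"

instance
proof
  fix x :: "'a \<times> 'b"
  show "x = 0" if "x \<in> sqs" "rip x x = 0"
    using that rip_nonneg[of "fst x"] rip_nonneg[of "snd x"]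
    by (auto simp: sqs_prod_def rip_prod_def prod_eq_iff add_nonneg_eq_0_iff intro: rip_eq_0_imp)
qed (auto simp: rscale_prod_def rip_prod_def sqs_prod_def rscale_add_right rscale_add_left
    rscale_rscale rscale_one rip_commute sqs_zero sqs_add sqs_rscale rip_add_right
    rip_rscale_right prod_eq_iff zero_prod_def algebra_simps intro: add_nonneg_nonneg)

end

lemma rscale_Pair [simp]: "rscale r (x, y) = (rscale r x, rscale r y)"
  by (simp add: rscale_prod_def)

lemma rip_Pair [simp]: "rip (x, y) (x', y') = rip x x' + rip y y'"
  by (simp add: rip_prod_def)

lemma subspace_sqs_Times [simp, intro!]:
  "subspace_sqs X \<Longrightarrow> subspace_sqs Y \<Longrightarrow> subspace_sqs (X \<times> Y)"
  by (auto simp: subspace_sqs_def sqs_prod_def zero_prod_def)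

text \<open>Both \<open>seg p\<close> and \<open>half_line\<close> consist of the square-summable families supported in a set.\<close>

lemma complete_sqs_supported:
  fixes S :: "'i set"
  defines "X \<equiv> {f :: 'i \<Rightarrow> 'a::{real_inner, complete_space}. f \<in> sqs \<and> (\<forall>k. k \<notin> S \<longrightarrow> f k = 0)}"
  shows "complete_sqs X"
proof -
  have sub: "subspace_sqs X"
    unfolding subspace_sqs_def X_def
    by (auto simp: sqs_zero sqs_add sqs_rscale) (simp add: rscale_fun_def)
  then have X: "X \<subseteq> sqs" by (simp add: subspace_sqs_def)
  interpret Metric_space X rdist by (rule Metric_space_rdist[OF X])
  have "\<exists>l. limitin mtopology \<sigma> l sequentially" if \<sigma>: "MCauchy \<sigma>" for \<sigma>
  proof -
    have \<sigma>X: "\<sigma> n \<in> X" for n using \<sigma> by (auto simp: MCauchy_def)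
    \<comment> \<open>Singletons \<open>F\<close> make every coordinate a Cauchy sequence; general
      finite \<open>F\<close> allow the limit in \<open>m\<close> to be taken before the supremum
      over \<open>F\<close>.\<close>
    have partial: "(\<Sum>k\<in>F. (norm (\<sigma> n k - \<sigma> m k))\<^sup>2) \<le> (rdist (\<sigma> n) (\<sigma> m))\<^sup>2" if "finite F" for F n m
    proof -
      have "\<sigma> n - \<sigma> m \<in> sqs" using \<sigma>X X sqs_diff by blast
      from finite_sum_le_infsum[OF summable_on_inner[OF this this] that]
      show ?thesis by (simp add: rdist_def rip_fun_def power2_norm_eq_inner infsum_nonneg)
    qed
    have "Cauchy (\<lambda>n. \<sigma> n k)" for k
    proof (rule metric_CauchyI)
      fix e :: real assume "e > 0"
      then obtain N where N: "\<And>n m. n \<ge> N \<Longrightarrow> m \<ge> N \<Longrightarrow> rdist (\<sigma> n) (\<sigma> m) < e"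
        using \<sigma> by (meson MCauchy_def)
      have "dist (\<sigma> n k) (\<sigma> m k) \<le> rdist (\<sigma> n) (\<sigma> m)" for n m
        using partial[of "{k}" n m] nonneg[of "\<sigma> n" "\<sigma> m"] by (simp add: dist_norm)
      then show "\<exists>M. \<forall>m\<ge>M. \<forall>n\<ge>M. dist (\<sigma> m k) (\<sigma> n k) < e"
        using N by (meson le_less_trans)
    qed
    then have "\<forall>k. \<exists>l. (\<lambda>n. \<sigma> n k) \<longlonglongrightarrow> l"
      by (simp add: Cauchy_convergent_iff convergent_def)
    then obtain l where l: "\<And>k. (\<lambda>n. \<sigma> n k) \<longlonglongrightarrow> l k" by metis
    have close: "\<sigma> n - l \<in> sqs \<and> rip (\<sigma> n - l) (\<sigma> n - l) \<le> e\<^sup>2"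
      if "\<And>m. m \<ge> N \<Longrightarrow> rdist (\<sigma> n) (\<sigma> m) < e" for n N e
    proof -
      have bound: "(\<Sum>k\<in>F. (norm ((\<sigma> n - l) k))\<^sup>2) \<le> e\<^sup>2" if F: "finite F" for F
      proof (rule tendsto_upperbound)
        show "(\<lambda>m. \<Sum>k\<in>F. (norm (\<sigma> n k - \<sigma> m k))\<^sup>2) \<longlonglongrightarrow> (\<Sum>k\<in>F. (norm ((\<sigma> n - l) k))\<^sup>2)"
          by (auto intro!: tendsto_intros l)
        have "(\<Sum>k\<in>F. (norm (\<sigma> n k - \<sigma> m k))\<^sup>2) \<le> e\<^sup>2" if "m \<ge> N" for m
          using partial[OF F, of n m] \<open>\<And>m. m \<ge> N \<Longrightarrow> rdist (\<sigma> n) (\<sigma> m) < e\<close>[OF that]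
            power_mono[of "rdist (\<sigma> n) (\<sigma> m)" e 2] nonneg[of "\<sigma> n" "\<sigma> m"] by linarith
        then show "eventually (\<lambda>m. (\<Sum>k\<in>F. (norm (\<sigma> n k - \<sigma> m k))\<^sup>2) \<le> e\<^sup>2) sequentially"
          by (auto simp: eventually_sequentially)
      qed simp
      then have "\<sigma> n - l \<in> sqs"
        unfolding sqs_fun_def
        by (auto intro!: nonneg_bdd_above_summable_on bdd_aboveI2[of _ _ "e\<^sup>2"])
      then show ?thesis
        using infsum_le_finite_sums[OF summable_on_inner, of "\<sigma> n - l" "\<sigma> n - l" "e\<^sup>2"] bound
        by (simp add: rip_fun_def power2_norm_eq_inner)
    qed
    have lX: "l \<in> X"
    proof -
      obtain N where "\<And>n m. n \<ge> N \<Longrightarrow> m \<ge> N \<Longrightarrow> rdist (\<sigma> n) (\<sigma> m) < 1"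
        using \<sigma> unfolding MCauchy_def by (meson zero_less_one)
      then have "\<sigma> N - l \<in> sqs" using close by blast
      then have "l \<in> sqs" using sqs_diff[of "\<sigma> N" "\<sigma> N - l"] \<sigma>X X by auto
      moreover have "l k = 0" if "k \<notin> S" for k
        using l[of k] \<sigma>X that by (auto simp: X_def LIMSEQ_const_iff)
      ultimately show ?thesis by (simp add: X_def)
    qed
    have "\<exists>N. \<forall>n\<ge>N. rdist (\<sigma> n) l < e" if "e > 0" for e
    proof -
      \<comment> \<open>Half of \<open>e\<close>, because the limit in \<open>close\<close> turns
        the strict bound into a non-strict one.\<close>
      have "e / 2 > 0" using that by simp
      then obtain N where "\<And>n m. n \<ge> N \<Longrightarrow> m \<ge> N \<Longrightarrow> rdist (\<sigma> n) (\<sigma> m) < e / 2"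
        using \<sigma> by (meson MCauchy_def)
      then have "rip (\<sigma> n - l) (\<sigma> n - l) \<le> (e / 2)\<^sup>2" if "n \<ge> N" for n
        using close that by blast
      then have "rdist (\<sigma> n) l \<le> e / 2" if "n \<ge> N" for n
        using real_sqrt_le_mono[of _ "(e / 2)\<^sup>2"] that \<open>e > 0\<close> by (fastforce simp: rdist_def)
      moreover have "e / 2 < e" using \<open>e > 0\<close> by simp
      ultimately show ?thesis by (meson le_less_trans)
    qed
    then show ?thesis using lX \<sigma>X by (auto simp: limit_metric_sequentially)
  qed
  then show ?thesis using sub by (auto simp: complete_sqs_def mcomplete_def)
qed

lemma seg_subset_sqs: "seg p \<subseteq> (sqs :: (nat \<Rightarrow> 'a::real_inner) set)"
proof
  fix f :: "nat \<Rightarrow> 'a" assume "f \<in> seg p"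
  then have "(\<lambda>k. (norm (f k))\<^sup>2) summable_on UNIV \<longleftrightarrow> (\<lambda>k. (norm (f k))\<^sup>2) summable_on {1..p}"
    by (intro summable_on_cong_neutral) (auto simp: seg_def)
  then show "f \<in> sqs" by (simp add: sqs_fun_def)
qed

lemma complete_sqs_seg [simp]: "complete_sqs (seg p :: (nat \<Rightarrow> 'a::{real_inner, complete_space}) set)"
proof -
  have "seg p = {f :: nat \<Rightarrow> 'a. f \<in> sqs \<and> (\<forall>k. k \<notin> {1..p} \<longrightarrow> f k = 0)}"
    using seg_subset_sqs[where ?'a = 'a, of p] by (auto simp: seg_def)
  then show ?thesis using complete_sqs_supported[where ?'a = 'a, of "{1..p}"] by simp
qed

lemma complete_sqs_half_line [simp]:
  "complete_sqs (half_line :: (int \<Rightarrow> 'a::{real_inner, complete_space}) set)"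
proof -
  have "half_line = {f :: int \<Rightarrow> 'a. f \<in> sqs \<and> (\<forall>k. k \<notin> {..<0} \<longrightarrow> f k = 0)}"
    by (auto simp: half_line_def sqs_fun_def)
  then show ?thesis using complete_sqs_supported[where ?'a = 'a, of "{..<0 :: int}"] by simp
qed

lemma complete_sqs_imp_subspace_sqs: "complete_sqs X \<Longrightarrow> subspace_sqs X"
  by (simp add: complete_sqs_def)

lemmas subspace_sqs_seg [simp] = complete_sqs_seg[THEN complete_sqs_imp_subspace_sqs]
lemmas subspace_sqs_half_line [simp] = complete_sqs_half_line[THEN complete_sqs_imp_subspace_sqs]

subsection \<open>Bounded coercive operators and Schur complements\<close>

definition linear_sqs :: "'x::ell2 set \<Rightarrow> 'y::ell2 set \<Rightarrow> ('x \<Rightarrow> 'y) \<Rightarrow> bool" where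
  "linear_sqs X Y M \<longleftrightarrow> (\<forall>x\<in>X. M x \<in> Y) \<and> (\<forall>x\<in>X. \<forall>y\<in>X. M (x + y) = M x + M y) \<and>
     (\<forall>r. \<forall>x\<in>X. M (rscale r x) = rscale r (M x))"

text \<open>Both bounds use squared norms, so that neither roots nor quotients occur. Symmetry is
  kept apart; it enters only when the blocks with values in East are recovered.\<close>

definition coercive_op :: "'x::ell2 set \<Rightarrow> ('x \<Rightarrow> 'x) \<Rightarrow> bool" where
  "coercive_op X M \<longleftrightarrow> linear_sqs X X M \<and>
     (\<exists>C. \<forall>x\<in>X. rip (M x) (M x) \<le> C * rip x x) \<and>
     (\<exists>c>0. \<forall>x\<in>X. c * rip x x \<le> rip x (M x))"

definition symmetric_op :: "'x::ell2 set \<Rightarrow> ('x \<Rightarrow> 'x) \<Rightarrow> bool" where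
  "symmetric_op X M \<longleftrightarrow> (\<forall>x\<in>X. \<forall>y\<in>X. rip (M x) y = rip x (M y))"

text \<open>The constant is made positive so that it can serve as a divisor.\<close>

lemma coercive_op_bound:
  assumes "coercive_op X M"
  obtains C where "C > 0" "\<forall>x\<in>X. rip (M x) (M x) \<le> C * rip x x"
proof -
  obtain C where C: "\<forall>x\<in>X. rip (M x) (M x) \<le> C * rip x x"
    using assms unfolding coercive_op_def by blast
  have "rip (M x) (M x) \<le> max C 1 * rip x x" if "x \<in> X" for x
    using C that mult_right_mono[of C "max C 1" "rip x x"] by fastforce
  then show thesis by (intro that[of "max C 1"] ballI) simp_all
qed

lemma coercive_op_lower_bound:
  assumes "coercive_op X M"
  obtains c where "c > 0" "\<forall>x\<in>X. c * rip x x \<le> rip x (M x)"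
  using assms that by (auto simp only: coercive_op_def)

lemma linear_sqs_mem: "linear_sqs X Y M \<Longrightarrow> x \<in> X \<Longrightarrow> M x \<in> Y"
  and linear_sqs_add: "linear_sqs X Y M \<Longrightarrow> x \<in> X \<Longrightarrow> y \<in> X \<Longrightarrow> M (x + y) = M x + M y"
  and linear_sqs_rscale: "linear_sqs X Y M \<Longrightarrow> x \<in> X \<Longrightarrow> M (rscale r x) = rscale r (M x)"
  by (auto simp: linear_sqs_def)

lemma linear_sqs_minus: "linear_sqs X Y M \<Longrightarrow> x \<in> X \<Longrightarrow> M (- x) = - M x"
  using linear_sqs_rscale[of X Y M x "- 1"] by (simp add: rscale_minus_one)

lemma linear_sqs_zero:
  assumes "linear_sqs X Y M" "subspace_sqs X"
  shows "M 0 = 0"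
  using linear_sqs_rscale[of X Y M 0 0] assms by (simp add: subspace_sqs_def)

lemma subspace_sqs_minus: "subspace_sqs X \<Longrightarrow> x \<in> X \<Longrightarrow> - x \<in> X"
  using subspace_sqs_diff[of X 0 x] by (simp add: subspace_sqs_def)

lemma linear_sqs_diff:
  assumes "linear_sqs X Y M" "subspace_sqs X" "x \<in> X" "y \<in> X"
  shows "M (x - y) = M x - M y"
  using linear_sqs_add[OF assms(1,3), of "- y"] assms
  by (simp add: linear_sqs_minus subspace_sqs_minus)

lemma subspace_sqs_zero [simp]: "subspace_sqs X \<Longrightarrow> 0 \<in> X"
  and subspace_sqs_add: "subspace_sqs X \<Longrightarrow> x \<in> X \<Longrightarrow> y \<in> X \<Longrightarrow> x + y \<in> X"
  and subspace_sqs_rscale: "subspace_sqs X \<Longrightarrow> x \<in> X \<Longrightarrow> rscale r x \<in> X"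
  and subspace_sqs_imp_sqs: "subspace_sqs X \<Longrightarrow> x \<in> X \<Longrightarrow> x \<in> sqs"
  by (auto simp: subspace_sqs_def)

text \<open>Lax--Milgram: the map \<open>v \<mapsto> v + t (y - A v)\<close> is a contraction for small \<open>t > 0\<close>.\<close>

lemma coercive_op_bij:
  assumes V: "complete_sqs V" and A: "coercive_op V A"
  shows "bij_betw A V V"
proof -
  have sub: "subspace_sqs V" and lin: "linear_sqs V V A"
    using V A by (simp_all add: complete_sqs_def coercive_op_def)
  note sqs = subspace_sqs_imp_sqs[OF sub] linear_sqs_mem[OF lin]
  obtain c where c: "c > 0" "\<forall>x\<in>V. c * rip x x \<le> rip x (A x)"
    using coercive_op_lower_bound[OF A] .
  note c = c(1) c(2)[rule_format]
  obtain C where C: "C > 0" "\<forall>x\<in>V. rip (A x) (A x) \<le> C * rip x x"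
    using coercive_op_bound[OF A] .
  note C = C(1) C(2)[rule_format]
  interpret Metric_space V rdist
    by (rule Metric_space_rdist) (use sub in \<open>simp add: subspace_sqs_def\<close>)
  have "inj_on A V"
  proof (rule inj_onI)
    fix u v assume uv: "u \<in> V" "v \<in> V" "A u = A v"
    then have "u - v \<in> V" "A (u - v) = 0"
      using sub lin by (simp_all add: subspace_sqs_diff linear_sqs_diff)
    then have "c * rip (u - v) (u - v) \<le> 0"
      using c(2)[of "u - v"] sqs by simp
    then have "rip (u - v) (u - v) = 0"
      using c(1) by (simp add: mult_le_0_iff order_antisym)
    then show "u = v"
      using rip_eq_0_imp[of "u - v"] \<open>u - v \<in> V\<close> sqs by simp
  qed
  moreover have "\<exists>v\<in>V. A v = y" if y: "y \<in> V" for y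
  proof -
    \<comment> \<open>The squared Lipschitz constant of \<open>F\<close> is at most
      \<open>1 - 2 * t * c + t * t * C\<close>. This \<open>t\<close> minimises that quadratic, with
      the value \<open>1 - c * c / C\<close>.\<close>
    define t where "t = c / C"
    define F where "F v = v + rscale t (y - A v)" for v
    have t: "t > 0" using c(1) C(1) by (simp add: t_def)
    have "rdist (F u) (F v) \<le> sqrt (1 - c\<^sup>2 / C) * rdist u v" if uv: "u \<in> V" "v \<in> V" for u v
    proof -
      define w where "w = u - v"
      have w: "w \<in> V" using uv sub by (simp add: w_def subspace_sqs_diff)
      have "rscale t (A w) = rscale t (y - A v) - rscale t (y - A u)"
        using rscale_add_right[of t "A w" "y - A u"] linear_sqs_diff[OF lin sub uv]
        by (simp add: w_def)
      then have eq: "F u - F v = w - rscale t (A w)"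
        by (simp add: F_def w_def)
      have "rip (F u - F v) (F u - F v) = rip w w - 2 * t * rip w (A w) + t\<^sup>2 * rip (A w) (A w)"
        using w unfolding eq
        by (simp add: sqs rip_diff_left rip_diff_right sqs_diff sqs_rscale rip_rscale_left
            rip_rscale_right rip_commute[of "A w" w] power2_eq_square algebra_simps)
      also have "\<dots> \<le> rip w w - 2 * t * (c * rip w w) + t\<^sup>2 * (C * rip w w)"
        using t C(2)[OF w] c(2)[OF w] by (intro add_mono diff_mono mult_left_mono) auto
      also have "\<dots> = (1 - c\<^sup>2 / C) * rip w w"
        using C(1) by (simp add: t_def field_simps power2_eq_square)
      finally show ?thesis
        unfolding rdist_def w_def[symmetric] real_sqrt_mult[symmetric]
        by (rule real_sqrt_le_mono)
    qed
    moreover have "sqrt (1 - c\<^sup>2 / C) < 1"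
      using c(1) C(1) by simp
    moreover have "F \<in> V \<rightarrow> V"
      using sub y sqs(2) by (auto simp: F_def subspace_sqs_add subspace_sqs_rscale subspace_sqs_diff)
    moreover have "mcomplete" "V \<noteq> {}" using V y by (auto simp: complete_sqs_def)
    ultimately obtain v where v: "v \<in> V" "F v = v"
      by (blast intro: Banach_fixedpoint_thm[of F "sqrt (1 - c\<^sup>2 / C)"])
    then have "rscale t (y - A v) = 0" by (simp add: F_def)
    then have "rscale (1 / t) (rscale t (y - A v)) = 0" by simp
    then have "y - A v = 0" using t by (simp add: rscale_rscale rscale_one)
    then show ?thesis using v by auto
  qed
  ultimately show ?thesis
    using sqs(2) by (force simp: bij_betw_def)
qed

text \<open>\<open>V\<close> carries the variable to be eliminated; it is assumed complete because
  Lax--Milgram has to invert the \<open>V\<close>-block.\<close>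

locale schur_setting =
  fixes X :: "'x::ell2 set" and V :: "'y::ell2 set" and T :: "'x \<times> 'y \<Rightarrow> 'x \<times> 'y"
  assumes X: "subspace_sqs X" and V: "complete_sqs V" and T: "coercive_op (X \<times> V) T"
begin

lemma sub_V: "subspace_sqs V"
  using V by (simp add: complete_sqs_def)

lemma lin: "linear_sqs (X \<times> V) (X \<times> V) T"
  using T by (simp add: coercive_op_def)

lemma T_split: "x \<in> X \<Longrightarrow> v \<in> V \<Longrightarrow> T (x, v) = T (x, 0) + T (0, v)"
  using linear_sqs_add[OF lin, of "(x, 0)" "(0, v)"] X sub_V by simp

lemma T_minus: "v \<in> V \<Longrightarrow> T (0, - v) = - T (0, v)"
  using linear_sqs_minus[OF lin, of "(0, v)"] X by simp

text \<open>The \<open>V\<close>-block is a compression of \<open>T\<close> and keeps both of its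
  constants, so Lax--Milgram applies to it.\<close>

lemma bij: "bij_betw (\<lambda>v. snd (T (0, v))) V V"
proof (rule coercive_op_bij[OF V])
  have 0: "(0, v) \<in> X \<times> V" if "v \<in> V" for v using X that by simp
  have mem: "T (0, v) \<in> X \<times> V" if "v \<in> V" for v
    using linear_sqs_mem[OF lin 0[OF that]] .
  have sqs: "fst (T (0, v)) \<in> sqs" if "v \<in> V" for v
    using mem[OF that] X by (auto simp: mem_Times_iff subspace_sqs_imp_sqs)
  obtain C where C: "C > 0" "\<forall>x\<in>X \<times> V. rip (T x) (T x) \<le> C * rip x x"
    using coercive_op_bound[OF T] .
  note C = C(1) C(2)[rule_format]
  obtain c where c: "c > 0" "\<forall>x\<in>X \<times> V. c * rip x x \<le> rip x (T x)"
    using coercive_op_lower_bound[OF T] .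
  note c = c(1) c(2)[rule_format]
  have "linear_sqs V V (\<lambda>v. snd (T (0, v)))"
    unfolding linear_sqs_def
  proof (intro conjI ballI allI)
    fix u v r assume u: "u \<in> V" and v: "v \<in> V"
    show "snd (T (0, u)) \<in> V" using mem[OF u] by (simp add: mem_Times_iff)
    show "snd (T (0, u + v)) = snd (T (0, u)) + snd (T (0, v))"
      using linear_sqs_add[OF lin 0[OF u] 0[OF v]] by simp
    show "snd (T (0, rscale r u)) = rscale r (snd (T (0, u)))"
      using linear_sqs_rscale[OF lin 0[OF u], of r] by (simp add: rscale_prod_def)
  qed
  moreover have "rip (snd (T (0, v))) (snd (T (0, v))) \<le> C * rip v v" if "v \<in> V" for v
    using C(2)[OF 0[OF that]] rip_nonneg[of "fst (T (0, v))"]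
    by (simp add: rip_prod_def del: rip_nonneg)
  moreover have "c * rip v v \<le> rip v (snd (T (0, v)))" if "v \<in> V" for v
    using c(2)[OF 0[OF that]] sqs[OF that] by (simp add: rip_prod_def)
  ultimately show "coercive_op V (\<lambda>v. snd (T (0, v)))"
    using c(1) unfolding coercive_op_def by blast
qed

lemma schur_ex:
  assumes x: "x \<in> X"
  shows "\<exists>v\<in>V. T (x, v) = (schur V T x, 0)"
proof -
  have "T (x, 0) \<in> X \<times> V" using linear_sqs_mem[OF lin] x sub_V by simp
  then have "snd (T (x, 0)) \<in> V" by (simp add: mem_Times_iff)
  \<comment> \<open>\<open>u\<close> is the argument of \<open>M12\<close> in \<open>schur\<close>;
    the common variable takes the value \<open>- u\<close>.\<close>
  define u where "u = inv_into V (\<lambda>v. snd (T (0, v))) (snd (T (x, 0)))"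
  have u: "u \<in> V" "snd (T (0, u)) = snd (T (x, 0))"
    using \<open>snd (T (x, 0)) \<in> V\<close> bij unfolding u_def
    by (auto simp: bij_betw_def inv_into_into f_inv_into_f[where f = "\<lambda>v. snd (T (0, v))"])
  have "T (x, - u) = T (x, 0) - T (0, u)"
    using T_split[OF x, of "- u"] u sub_V by (simp add: T_minus subspace_sqs_minus)
  then have "T (x, - u) = (schur V T x, 0)"
    using u(2) by (simp add: schur_def Let_def prod_eq_iff u_def)
  then show ?thesis using u(1) sub_V subspace_sqs_minus by blast
qed

text \<open>The \<open>V\<close>-block is injective, so any \<open>v\<close> that annihilates the
  second component is the one built into \<open>schur\<close>. Together with \<open>schur_ex\<close>
  this replaces computations with inverses by the exhibition of a \<open>v\<close>.\<close>

lemma schur_eqI: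
  assumes x: "x \<in> X" and v: "v \<in> V" and eq: "T (x, v) = (y, 0)"
  shows "schur V T x = y"
proof -
  have "snd (T (0, - v)) = snd (T (x, 0))"
    using eq T_split[OF x v] v by (simp add: T_minus prod_eq_iff eq_neg_iff_add_eq_0 minus_equation_iff
        neg_eq_iff_add_eq_0 add.commute)
  then have "inv_into V (\<lambda>v. snd (T (0, v))) (snd (T (x, 0))) = - v"
    using bij v sub_V inv_into_f_f[of "\<lambda>v. snd (T (0, v))" V "- v"]
    by (simp add: bij_betw_def subspace_sqs_minus)
  then show ?thesis
    using eq T_split[OF x v] v by (simp add: schur_def Let_def T_minus prod_eq_iff)
qed

text \<open>The values of the common variable for \<open>x\<close> and \<open>y\<close> add up to an
  admissible value for \<open>x + y\<close>, and by uniqueness it is the right one; likewise for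
  multiples.\<close>

lemma schur_linear: "linear_sqs X X (schur V T)"
  unfolding linear_sqs_def
proof (intro conjI ballI allI)
  fix x y r assume x: "x \<in> X" and y: "y \<in> X"
  obtain u where u: "u \<in> V" "T (x, u) = (schur V T x, 0)" using schur_ex[OF x] by blast
  obtain v where v: "v \<in> V" "T (y, v) = (schur V T y, 0)" using schur_ex[OF y] by blast
  show "schur V T x \<in> X" using linear_sqs_mem[OF lin, of "(x, u)"] u x by simp
  have "T (x + y, u + v) = T (x, u) + T (y, v)"
    using linear_sqs_add[OF lin, of "(x, u)" "(y, v)"] u v x y by simp
  then show "schur V T (x + y) = schur V T x + schur V T y"
    using u v x y X sub_V by (intro schur_eqI[of _ "u + v"]) (auto simp: subspace_sqs_add)
  have "T (rscale r x, rscale r u) = rscale r (T (x, u))"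
    using linear_sqs_rscale[OF lin, of "(x, u)" r] u x by simp
  then show "schur V T (rscale r x) = rscale r (schur V T x)"
    using u x X sub_V by (intro schur_eqI[of _ "rscale r u"]) (auto simp: subspace_sqs_rscale)
qed

text \<open>If \<open>T (x, v) = (y, 0)\<close>, then the form of \<open>T\<close> at
  \<open>(x, v)\<close> is \<open>rip x y\<close>, so the lower constant \<open>c\<close> is
  inherited. The same identity controls \<open>v\<close> without any bound on the inverse:
  \<open>rip y y\<close> is at most \<open>C * (rip x x + rip v v)\<close>, hence at most
  \<open>(C / c) * rip x y\<close>, and Cauchy--Schwarz gives the upper constant, the square of
  \<open>C / c\<close>.\<close>

lemma schur_coercive_op: "coercive_op X (schur V T)"
proof -
  obtain C where C: "C > 0" "\<forall>x\<in>X \<times> V. rip (T x) (T x) \<le> C * rip x x"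
    using coercive_op_bound[OF T] .
  note C = C(1) C(2)[rule_format]
  obtain c where c: "c > 0" "\<forall>x\<in>X \<times> V. c * rip x x \<le> rip x (T x)"
    using coercive_op_lower_bound[OF T] .
  note c = c(1) c(2)[rule_format]
  have *: "c * rip x x \<le> rip x (schur V T x) \<and>
      rip (schur V T x) (schur V T x) \<le> (C / c)\<^sup>2 * rip x x" if x: "x \<in> X" for x
  proof -
    define y where "y = schur V T x"
    obtain v where v: "v \<in> V" "T (x, v) = (y, 0)" using schur_ex[OF x] by (auto simp: y_def)
    have sqs: "x \<in> sqs" "v \<in> sqs" "y \<in> sqs"
      using x v X sub_V linear_sqs_mem[OF schur_linear x]
      by (auto simp: y_def subspace_sqs_imp_sqs)
    have 1: "c * (rip x x + rip v v) \<le> rip x y"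
      using c(2)[of "(x, v)"] v x sqs by simp
    have 2: "rip y y \<le> C * (rip x x + rip v v)"
      using C(2)[of "(x, v)"] v x sqs by simp
    have "c * rip v v \<ge> 0" using c(1) by simp
    then have "c * rip x x \<le> rip x y" using 1 by (simp add: distrib_left)
    have "rip y y \<le> (C / c) * rip x y"
      using 2 mult_left_mono[OF 1, of "C / c"] c(1) C(1) by simp
    then have "(rip y y)\<^sup>2 \<le> ((C / c) * rip x y)\<^sup>2"
      by (intro power_mono) simp_all
    also have "\<dots> \<le> (C / c)\<^sup>2 * (rip x x * rip y y)"
      unfolding power_mult_distrib using sqs by (intro mult_left_mono rip_cauchy_schwarz) auto
    finally have "rip y y * rip y y \<le> ((C / c)\<^sup>2 * rip x x) * rip y y"
      by (simp add: power2_eq_square mult_ac)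
    then have "rip y y \<le> (C / c)\<^sup>2 * rip x x"
      using rip_nonneg[of y] by (cases "rip y y = 0") (simp_all add: mult_le_cancel_right order_less_le)
    then show ?thesis using \<open>c * rip x x \<le> rip x y\<close> by (simp add: y_def)
  qed
  then show ?thesis
    using schur_linear c(1) unfolding coercive_op_def by blast
qed

text \<open>Both \<open>T (x, u)\<close> and \<open>T (y, v)\<close> vanish in \<open>V\<close>, so
  the eliminated variables drop out of the two pairings.\<close>

lemma schur_symmetric:
  assumes "symmetric_op (X \<times> V) T"
  shows "symmetric_op X (schur V T)"
  unfolding symmetric_op_def
proof (intro ballI)
  fix x y assume x: "x \<in> X" and y: "y \<in> X"
  obtain u where u: "u \<in> V" "T (x, u) = (schur V T x, 0)" using schur_ex[OF x] by blast
  obtain v where v: "v \<in> V" "T (y, v) = (schur V T y, 0)" using schur_ex[OF y] by blast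
  have "rip (T (x, u)) (y, v) = rip (x, u) (T (y, v))"
    using assms x y u(1) v(1) by (auto simp: symmetric_op_def)
  then show "rip (schur V T x) y = rip x (schur V T y)"
    using u v subspace_sqs_imp_sqs[OF sub_V] by simp
qed

end

text \<open>Meant for \<open>J\<close> built from \<open>uncat\<close> and \<open>J'\<close> built
  from \<open>cat\<close>. Isometry is asked of \<open>J'\<close>; that of \<open>J\<close> follows,
  since \<open>J'\<close> undoes it.\<close>

lemma coercive_op_conj:
  assumes S: "coercive_op X S" and X: "subspace_sqs X"
    and J: "linear_sqs Y X J" and J': "linear_sqs X Y J'"
    and inv: "\<And>y. y \<in> Y \<Longrightarrow> J' (J y) = y"
    and iso: "\<And>x x'. x \<in> X \<Longrightarrow> x' \<in> X \<Longrightarrow> rip (J' x) (J' x') = rip x x'"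
    and M: "\<And>y. y \<in> Y \<Longrightarrow> M y = J' (S (J y))"
    and Y: "subspace_sqs Y"
  shows "coercive_op Y M"
proof -
  have SX: "linear_sqs X X S" using S by (simp add: coercive_op_def)
  obtain C where C: "C > 0" "\<forall>x\<in>X. rip (S x) (S x) \<le> C * rip x x"
    using coercive_op_bound[OF S] .
  note C = C(1) C(2)[rule_format]
  obtain c where c: "c > 0" "\<forall>x\<in>X. c * rip x x \<le> rip x (S x)"
    using coercive_op_lower_bound[OF S] .
  note c = c(1) c(2)[rule_format]
  note mem = linear_sqs_mem[OF J] linear_sqs_mem[OF J'] linear_sqs_mem[OF SX]
  have iso': "rip (J y) (J y) = rip y y" if "y \<in> Y" for y
    using iso[of "J y" "J y"] inv that mem by simp
  have "linear_sqs Y Y M"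
    unfolding linear_sqs_def
    using Y by (auto simp: M mem linear_sqs_add[OF J] linear_sqs_add[OF J'] linear_sqs_add[OF SX]
        linear_sqs_rscale[OF J] linear_sqs_rscale[OF J'] linear_sqs_rscale[OF SX]
        subspace_sqs_add subspace_sqs_rscale)
  moreover have "rip (M y) (M y) \<le> C * rip y y" if "y \<in> Y" for y
    using C(2)[of "J y"] that by (simp add: M iso iso' mem)
  moreover have "c * rip y y \<le> rip y (M y)" if "y \<in> Y" for y
    using c(2)[of "J y"] iso[of "J y" "S (J y)"] that by (simp add: M iso' mem inv)
  ultimately show ?thesis using c(1) unfolding coercive_op_def by blast
qed

subsection \<open>Gluing\<close>

text \<open>The sum of two quadratic forms in overlapping sets of variables: \<open>R\<^sub>i\<close> selects the variables of
  the \<open>i\<close>-th form and \<open>E\<^sub>i\<close> is its adjoint.\<close>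

locale overlapping_sum =
  fixes Z :: "'z::ell2 set" and X1 :: "'x::ell2 set" and X2 :: "'y::ell2 set"
    and R1 E1 R2 E2
  assumes Z: "subspace_sqs Z" and X1: "subspace_sqs X1" and X2: "subspace_sqs X2"
    and R1: "linear_sqs Z X1 R1" and E1: "linear_sqs X1 Z E1"
    and R2: "linear_sqs Z X2 R2" and E2: "linear_sqs X2 Z E2"
    and adj1: "\<And>z x. z \<in> Z \<Longrightarrow> x \<in> X1 \<Longrightarrow> rip z (E1 x) = rip (R1 z) x"
    and adj2: "\<And>z x. z \<in> Z \<Longrightarrow> x \<in> X2 \<Longrightarrow> rip z (E2 x) = rip (R2 z) x"
    and iso1: "\<And>x. x \<in> X1 \<Longrightarrow> rip (E1 x) (E1 x) = rip x x"
    and iso2: "\<And>x. x \<in> X2 \<Longrightarrow> rip (E2 x) (E2 x) = rip x x"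
    and covers: "\<And>z. z \<in> Z \<Longrightarrow> rip z z \<le> rip (R1 z) (R1 z) + rip (R2 z) (R2 z)"
    and covers_twice: "\<And>z. z \<in> Z \<Longrightarrow> rip (R1 z) (R1 z) + rip (R2 z) (R2 z) \<le> 2 * rip z z"
begin

text \<open>Every variable occurs in at least one form (\<open>covers\<close>), which yields the
  lower constant \<open>min c1 c2\<close>. It occurs in at most two (\<open>covers_twice\<close>),
  which accounts for one factor 2 of the upper constant; the other one is the parallelogram bound
  for the norm of \<open>u + v\<close>.\<close>

lemma coercive_op_sum:
  assumes M1: "coercive_op X1 M1" and M2: "coercive_op X2 M2"
    and T: "\<And>z. z \<in> Z \<Longrightarrow> T z = E1 (M1 (R1 z)) + E2 (M2 (R2 z))"
  shows "coercive_op Z T"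
proof -
  have lin: "linear_sqs X1 X1 M1" "linear_sqs X2 X2 M2"
    using M1 M2 by (simp_all add: coercive_op_def)
  note mem = linear_sqs_mem[OF R1] linear_sqs_mem[OF R2] linear_sqs_mem[OF E1] linear_sqs_mem[OF E2]
    linear_sqs_mem[OF lin(1)] linear_sqs_mem[OF lin(2)]
  obtain C1 where C1: "C1 > 0" "\<forall>x\<in>X1. rip (M1 x) (M1 x) \<le> C1 * rip x x"
    using coercive_op_bound[OF M1] .
  obtain C2 where C2: "C2 > 0" "\<forall>x\<in>X2. rip (M2 x) (M2 x) \<le> C2 * rip x x"
    using coercive_op_bound[OF M2] .
  obtain c1 where c1: "c1 > 0" "\<forall>x\<in>X1. c1 * rip x x \<le> rip x (M1 x)"
    using coercive_op_lower_bound[OF M1] .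
  obtain c2 where c2: "c2 > 0" "\<forall>x\<in>X2. c2 * rip x x \<le> rip x (M2 x)"
    using coercive_op_lower_bound[OF M2] .
  have "linear_sqs Z Z T"
    unfolding linear_sqs_def
  proof (intro conjI ballI allI)
    fix x y r assume xy: "x \<in> Z" "y \<in> Z"
    show "T x \<in> Z" using xy Z by (simp add: T mem subspace_sqs_add)
    show "T (x + y) = T x + T y"
      using xy Z by (simp add: T subspace_sqs_add mem linear_sqs_add[OF R1] linear_sqs_add[OF R2]
          linear_sqs_add[OF E1] linear_sqs_add[OF E2] linear_sqs_add[OF lin(1)] linear_sqs_add[OF lin(2)])
    show "T (rscale r x) = rscale r (T x)"
      using xy Z by (simp add: T subspace_sqs_rscale mem linear_sqs_rscale[OF R1]
          linear_sqs_rscale[OF R2] linear_sqs_rscale[OF E1] linear_sqs_rscale[OF E2]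
          linear_sqs_rscale[OF lin(1)] linear_sqs_rscale[OF lin(2)] rscale_add_right)
  qed
  moreover have "rip (T z) (T z) \<le> (4 * max C1 C2) * rip z z" if z: "z \<in> Z" for z
  proof -
    define u v where "u = E1 (M1 (R1 z))" and "v = E2 (M2 (R2 z))"
    have sqs: "u \<in> sqs" "v \<in> sqs"
      using z mem subspace_sqs_imp_sqs[OF Z] by (auto simp: u_def v_def)
    have "0 \<le> rip (u - v) (u - v)" by simp
    then have "rip (u + v) (u + v) \<le> 2 * (rip u u + rip v v)"
      using sqs by (simp add: rip_diff_left rip_diff_right sqs_diff rip_add_left rip_add_right
          sqs_add rip_commute[of v u] del: rip_nonneg)
    also have "\<dots> \<le> 2 * (C1 * rip (R1 z) (R1 z) + C2 * rip (R2 z) (R2 z))"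
      using C1 C2 z by (simp add: u_def v_def iso1 iso2 mem add_mono)
    also have "\<dots> \<le> 2 * (max C1 C2 * rip (R1 z) (R1 z) + max C1 C2 * rip (R2 z) (R2 z))"
      by (intro mult_left_mono add_mono mult_right_mono) auto
    also have "\<dots> \<le> 2 * (max C1 C2 * (2 * rip z z))"
      using covers_twice[OF z] C1(1) by (simp only: distrib_left[symmetric]) (intro mult_left_mono; simp)
    finally show ?thesis using z by (simp add: T u_def v_def)
  qed
  moreover have "min c1 c2 * rip z z \<le> rip z (T z)" if z: "z \<in> Z" for z
  proof -
    have "min c1 c2 * rip z z \<le> min c1 c2 * (rip (R1 z) (R1 z) + rip (R2 z) (R2 z))"
      using covers[OF z] c1(1) c2(1) by (intro mult_left_mono) auto
    also have "\<dots> \<le> c1 * rip (R1 z) (R1 z) + c2 * rip (R2 z) (R2 z)"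
      unfolding distrib_left by (intro add_mono mult_right_mono) auto
    also have "\<dots> \<le> rip (R1 z) (M1 (R1 z)) + rip (R2 z) (M2 (R2 z))"
      using c1 c2 z by (intro add_mono) (auto simp: mem)
    also have "\<dots> = rip z (T z)"
      using z Z by (simp add: T mem rip_add_right subspace_sqs_imp_sqs adj1 adj2)
    finally show ?thesis .
  qed
  moreover have "min c1 c2 > 0" using c1(1) c2(1) by simp
  ultimately show ?thesis unfolding coercive_op_def by metis
qed

lemma symmetric_op_sum:
  assumes lin: "linear_sqs X1 X1 M1" "linear_sqs X2 X2 M2"
    and sym: "symmetric_op X1 M1" "symmetric_op X2 M2"
    and T: "\<And>z. z \<in> Z \<Longrightarrow> T z = E1 (M1 (R1 z)) + E2 (M2 (R2 z))"
  shows "symmetric_op Z T"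
proof -
  note mem = linear_sqs_mem[OF R1] linear_sqs_mem[OF R2] linear_sqs_mem[OF E1] linear_sqs_mem[OF E2]
    linear_sqs_mem[OF lin(1)] linear_sqs_mem[OF lin(2)]
  have *: "rip z (T z') = rip (R1 z) (M1 (R1 z')) + rip (R2 z) (M2 (R2 z'))"
    if "z \<in> Z" "z' \<in> Z" for z z'
    using that Z by (simp add: T mem rip_add_right subspace_sqs_imp_sqs adj1 adj2)
  have "rip (R1 z) (M1 (R1 z')) = rip (R1 z') (M1 (R1 z))"
       "rip (R2 z) (M2 (R2 z')) = rip (R2 z') (M2 (R2 z))" if "z \<in> Z" "z' \<in> Z" for z z'
    using that sym mem by (metis rip_commute symmetric_op_def)+
  then show ?thesis
    unfolding symmetric_op_def by (simp add: * rip_commute[of "T _"])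
qed

end

section \<open>Carriers and concatenation of segments\<close>

lemma subspace_sqs_rect_space [simp]:
  "subspace_sqs (rect_space p q :: ('a::{real_inner, complete_space}, 'b::{real_inner, complete_space}) rect_vec set)"
  unfolding rect_space_def by auto

lemma subspace_sqs_half_space [simp]:
  "subspace_sqs (half_space q :: ('a::{real_inner, complete_space}, 'b::{real_inner, complete_space}) half_vec set)"
  unfolding half_space_def by auto

lemmas sqs_simps = subspace_sqs_imp_sqs[OF subspace_sqs_seg] subspace_sqs_imp_sqs[OF subspace_sqs_half_line]
lemmas closed_simps = subspace_sqs_add[OF subspace_sqs_seg] subspace_sqs_add[OF subspace_sqs_half_line]
  subspace_sqs_rscale[OF subspace_sqs_seg] subspace_sqs_rscale[OF subspace_sqs_half_line]
  subspace_sqs_minus[OF subspace_sqs_seg] subspace_sqs_minus[OF subspace_sqs_half_line]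

lemma seg_memD: "u \<in> seg p \<Longrightarrow> k = 0 \<or> p < k \<Longrightarrow> u k = 0"
  by (auto simp: seg_def)

lemma rip_seg: "u \<in> seg p \<Longrightarrow> rip u v = (\<Sum>k=1..p. u k \<bullet> v k)"
  unfolding rip_fun_def infsum_finite[symmetric, OF finite_atLeastAtMost]
  by (intro infsum_cong_neutral) (auto simp: seg_def)

lemma cat_mem: "u \<in> seg p \<Longrightarrow> u' \<in> seg p' \<Longrightarrow> cat p (u, u') \<in> seg (p + p')"
  using seg_memD[of u p] seg_memD[of u' p'] unfolding seg_def[of "p + p'"] by (auto simp: cat_def)

lemma uncat_mem: "v \<in> seg (p + p') \<Longrightarrow> uncat p v \<in> seg p \<times> seg p'"
  by (auto simp: uncat_def seg_def)

text \<open>No membership is required because index 0, which lies outside every segment, is kept in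
  the first component by both maps.\<close>

lemma cat_uncat [simp]: "cat p (uncat p v) = v"
  by (auto simp: cat_def uncat_def fun_eq_iff)

text \<open>This form fits goals in which case splits have already replaced \<open>uncat p v\<close>
  by a pair.\<close>

lemma cat_eqI: "uncat p v = z \<Longrightarrow> cat p z = v"
  by auto

lemma uncat_cat: "u \<in> seg p \<Longrightarrow> u' \<in> seg p' \<Longrightarrow> uncat p (cat p (u, u')) = (u, u')"
  by (auto simp: cat_def uncat_def fun_eq_iff seg_memD)

lemma cat_add: "cat p (u + v, u' + v') = cat p (u, u') + cat p (v, v')"
  and cat_rscale: "cat p (rscale r u, rscale r u') = rscale r (cat p (u, u'))"
  by (auto simp: cat_def fun_eq_iff rscale_fun_def)

lemma uncat_add: "uncat p (u + v) = uncat p u + uncat p (v :: nat \<Rightarrow> 'a::real_inner)"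
  and uncat_rscale: "uncat p (rscale r u) = rscale r (uncat p u)"
  by (auto simp: uncat_def fun_eq_iff rscale_fun_def)

lemma rip_cat:
  assumes "u \<in> seg p" "u' \<in> seg p'"
  shows "rip (cat p (u, u')) (cat p (v, v')) = rip u v + rip u' v'"
proof -
  have "rip (cat p (u, u')) (cat p (v, v')) = (\<Sum>k=1..p+p'. cat p (u, u') k \<bullet> cat p (v, v') k)"
    by (rule rip_seg[OF cat_mem[OF assms]])
  also have "\<dots> = (\<Sum>k=1..p. u k \<bullet> v k) + (\<Sum>k=p+1..p+p'. cat p (u, u') k \<bullet> cat p (v, v') k)"
    by (subst sum.ub_add_nat) (auto simp: cat_def)
  also have "(\<Sum>k=p+1..p+p'. cat p (u, u') k \<bullet> cat p (v, v') k) = (\<Sum>k=1..p'. u' k \<bullet> v' k)"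
    by (rule sum.reindex_bij_witness[of _ "\<lambda>k. k + p" "\<lambda>k. k - p"]) (auto simp: cat_def)
  finally show ?thesis using assms by (simp add: rip_seg)
qed

section \<open>The gluings as overlapping sums followed by Schur complements\<close>

lemma overlapping_rect_hsum:
  "overlapping_sum
     (((seg p \<times> seg p') \<times> (seg p \<times> seg p') \<times> seg q \<times> seg q) \<times> seg q)
     (rect_space p q :: ('a::{real_inner, complete_space}, 'b::{real_inner, complete_space}) rect_vec set)
     (rect_space p' q :: ('a, 'b) rect_vec set)
     (\<lambda>(((s, s'), (n, n'), w, e), v). (s, n, w, v)) (\<lambda>(s, n, w, e). (((s, 0), (n, 0), w, 0), e))
     (\<lambda>(((s, s'), (n, n'), w, e), v). (s', n', v, e)) (\<lambda>(s, n, w, e). (((0, s), (0, n), 0, e), w))"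
  by standard (auto simp: rect_space_def linear_sqs_def sqs_simps closed_simps)

lemma overlapping_rect_vsum:
  "overlapping_sum
     ((seg p \<times> seg p \<times> (seg q \<times> seg q') \<times> (seg q \<times> seg q')) \<times> seg p)
     (rect_space p q :: ('a::{real_inner, complete_space}, 'b::{real_inner, complete_space}) rect_vec set)
     (rect_space p q' :: ('a, 'b) rect_vec set)
     (\<lambda>((s, n, (w, w'), (e, e')), v). (s, v, w, e)) (\<lambda>(s, n, w, e). ((s, 0, (w, 0), (e, 0)), n))
     (\<lambda>((s, n, (w, w'), (e, e')), v). (v, n, w', e')) (\<lambda>(s, n, w, e). ((0, n, (0, w), (0, e)), s))"
  by standard (auto simp: rect_space_def linear_sqs_def sqs_simps closed_simps)

lemma overlapping_half_vsum:
  "overlapping_sum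
     ((half_line \<times> half_line \<times> (seg q \<times> seg q')) \<times> half_line)
     (half_space q :: ('a::{real_inner, complete_space}, 'b::{real_inner, complete_space}) half_vec set)
     (half_space q' :: ('a, 'b) half_vec set)
     (\<lambda>((s, n, (e, e')), v). (s, v, e)) (\<lambda>(s, n, e). ((s, 0, (e, 0)), n))
     (\<lambda>((s, n, (e, e')), v). (v, n, e')) (\<lambda>(s, n, e). ((0, n, (0, e)), s))"
  by standard (auto simp: half_space_def linear_sqs_def sqs_simps closed_simps)

lemma overlapping_half_hsum:
  "overlapping_sum
     (((half_line \<times> seg p) \<times> (half_line \<times> seg p) \<times> seg q) \<times> seg q)
     (half_space q :: ('a::{real_inner, complete_space}, 'b::{real_inner, complete_space}) half_vec set)
     (rect_space p q :: ('a, 'b) rect_vec set)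
     (\<lambda>(((s, s'), (n, n'), e), v). (s, n, v)) (\<lambda>(s, n, e). (((s, 0), (n, 0), 0), e))
     (\<lambda>(((s, s'), (n, n'), e), v). (s', n', v, e)) (\<lambda>(s, n, w, e). (((0, s), (0, n), e), w))"
  by standard (auto simp: half_space_def rect_space_def linear_sqs_def sqs_simps closed_simps)

lemma schur_setting_rect_hsum:
  fixes M M' :: "('a::{real_inner, complete_space}, 'b::{real_inner, complete_space}) rect_vec \<Rightarrow> ('a, 'b) rect_vec"
  assumes "coercive_op (rect_space p q) M" "coercive_op (rect_space p' q) M'"
  shows "schur_setting ((seg p \<times> seg p') \<times> (seg p \<times> seg p') \<times> seg q \<times> seg q) (seg q) (rect_hsum M M')"
proof
  show "coercive_op (((seg p \<times> seg p') \<times> (seg p \<times> seg p') \<times> seg q \<times> seg q) \<times> seg q) (rect_hsum M M')"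
    by (rule overlapping_sum.coercive_op_sum[OF overlapping_rect_hsum assms])
      (auto simp: rect_hsum_def split: prod.split)
qed auto

lemma schur_setting_rect_vsum:
  fixes M M' :: "('a::{real_inner, complete_space}, 'b::{real_inner, complete_space}) rect_vec \<Rightarrow> ('a, 'b) rect_vec"
  assumes "coercive_op (rect_space p q) M" "coercive_op (rect_space p q') M'"
  shows "schur_setting (seg p \<times> seg p \<times> (seg q \<times> seg q') \<times> (seg q \<times> seg q')) (seg p) (rect_vsum M M')"
proof
  show "coercive_op ((seg p \<times> seg p \<times> (seg q \<times> seg q') \<times> (seg q \<times> seg q')) \<times> seg p) (rect_vsum M M')"
    by (rule overlapping_sum.coercive_op_sum[OF overlapping_rect_vsum assms])
      (auto simp: rect_vsum_def split: prod.split)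
qed auto

lemma schur_setting_half_vsum:
  fixes M M' :: "('a::{real_inner, complete_space}, 'b::{real_inner, complete_space}) half_vec \<Rightarrow> ('a, 'b) half_vec"
  assumes "coercive_op (half_space q) M" "coercive_op (half_space q') M'"
  shows "schur_setting (half_line \<times> half_line \<times> (seg q \<times> seg q')) half_line (half_vsum M M')"
proof
  show "coercive_op ((half_line \<times> half_line \<times> (seg q \<times> seg q')) \<times> half_line) (half_vsum M M')"
    by (rule overlapping_sum.coercive_op_sum[OF overlapping_half_vsum assms])
      (auto simp: half_vsum_def split: prod.split)
qed auto

text \<open>Isolated because coercivity and symmetry of this sum both rest on the
  decomposition.\<close>

lemma half_hsum_eq:
  fixes M :: "('a::{real_inner, complete_space}, 'b::{real_inner, complete_space}) half_vec \<Rightarrow> ('a, 'b) half_vec"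
    and P :: "('a, 'b) rect_vec \<Rightarrow> ('a, 'b) rect_vec"
  assumes "z \<in> ((half_line \<times> seg p) \<times> (half_line \<times> seg p) \<times> seg q) \<times> seg q"
  shows "half_hsum M P z =
    (\<lambda>(s, n, e). (((s, 0), (n, 0), 0), e)) (M ((\<lambda>(((s, s'), (n, n'), e), v). (s, n, v)) z)) +
    (\<lambda>(s, n, w, e). (((0, s), (0, n), e), w)) (P ((\<lambda>(((s, s'), (n, n'), e), v). (s', n', v, e)) z))"
  by (cases z) (auto simp: half_hsum_def split: prod.split)

lemma schur_setting_half_hsum:
  fixes M :: "('a::{real_inner, complete_space}, 'b::{real_inner, complete_space}) half_vec \<Rightarrow> ('a, 'b) half_vec"
    and P :: "('a, 'b) rect_vec \<Rightarrow> ('a, 'b) rect_vec"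
  assumes "coercive_op (half_space q) M" "coercive_op (rect_space p q) P"
  shows "schur_setting ((half_line \<times> seg p) \<times> (half_line \<times> seg p) \<times> seg q) (seg q) (half_hsum M P)"
proof
  show "coercive_op (((half_line \<times> seg p) \<times> (half_line \<times> seg p) \<times> seg q) \<times> seg q) (half_hsum M P)"
    by (rule overlapping_sum.coercive_op_sum[OF overlapping_half_hsum assms]) (rule half_hsum_eq)
qed auto

lemma coercive_op_rect_hglue:
  fixes M M' :: "('a::{real_inner, complete_space}, 'b::{real_inner, complete_space}) rect_vec \<Rightarrow> ('a, 'b) rect_vec"
  assumes "coercive_op (rect_space p q) M" "coercive_op (rect_space p' q) M'"
  shows "coercive_op (rect_space (p + p') q) (rect_hglue p p' q M M')"
  by (rule coercive_op_conj[OF schur_setting.schur_coercive_op[OF schur_setting_rect_hsum[OF assms]],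
        where J = "\<lambda>(s, n, w, e). (uncat p s, uncat p n, w, e)"
          and J' = "\<lambda>(s, n, w, e). (cat p s, cat p n, w, e)"])
    (auto simp: rect_hglue_def rect_space_def linear_sqs_def cat_mem cat_add cat_rscale rip_cat
       uncat_add uncat_rscale split: prod.split dest: uncat_mem intro: cat_eqI)

lemma coercive_op_rect_vglue:
  fixes M M' :: "('a::{real_inner, complete_space}, 'b::{real_inner, complete_space}) rect_vec \<Rightarrow> ('a, 'b) rect_vec"
  assumes "coercive_op (rect_space p q) M" "coercive_op (rect_space p q') M'"
  shows "coercive_op (rect_space p (q + q')) (rect_vglue p q q' M M')"
  by (rule coercive_op_conj[OF schur_setting.schur_coercive_op[OF schur_setting_rect_vsum[OF assms]],
        where J = "\<lambda>(s, n, w, e). (s, n, uncat q w, uncat q e)"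
          and J' = "\<lambda>(s, n, w, e). (s, n, cat q w, cat q e)"])
    (auto simp: rect_vglue_def rect_space_def linear_sqs_def cat_mem cat_add cat_rscale rip_cat
       uncat_add uncat_rscale split: prod.split dest: uncat_mem intro: cat_eqI)

lemma coercive_op_half_vglue:
  fixes M M' :: "('a::{real_inner, complete_space}, 'b::{real_inner, complete_space}) half_vec \<Rightarrow> ('a, 'b) half_vec"
  assumes "coercive_op (half_space q) M" "coercive_op (half_space q') M'"
  shows "coercive_op (half_space (q + q')) (half_vglue q q' M M')"
  by (rule coercive_op_conj[OF schur_setting.schur_coercive_op[OF schur_setting_half_vsum[OF assms]],
        where J = "\<lambda>(s, n, e). (s, n, uncat q e)"
          and J' = "\<lambda>(s, n, e). (s, n, cat q e)"])
    (auto simp: half_vglue_def half_space_def linear_sqs_def cat_mem cat_add cat_rscale rip_cat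
       uncat_add uncat_rscale split: prod.split dest: uncat_mem intro: cat_eqI)

text \<open>\<open>v\<close> is the common value on the shared side, and the responses
  \<open>m\<close> and \<open>- m\<close> of the two shapes cancel there. The analogous rules for
  the other gluings have the same shape.\<close>

lemma rect_hglue_eqI:
  fixes M M' :: "('a::{real_inner, complete_space}, 'b::{real_inner, complete_space}) rect_vec \<Rightarrow> ('a, 'b) rect_vec"
  assumes "coercive_op (rect_space p q) M" "coercive_op (rect_space p' q) M'"
    and "s \<in> seg p" "s' \<in> seg p'" "n \<in> seg p" "n' \<in> seg p'" "w \<in> seg q" "e \<in> seg q" "v \<in> seg q"
    and "M (s, n, w, v) = (ys, yn, yw, m)" "M' (s', n', v, e) = (ys', yn', - m, ye)"
  shows "rect_hglue p p' q M M' (cat p (s, s'), cat p (n, n'), w, e) =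
    (cat p (ys, ys'), cat p (yn, yn'), yw, ye)"
proof -
  have "schur (seg q) (rect_hsum M M') ((s, s'), (n, n'), w, e) = ((ys, ys'), (yn, yn'), yw, ye)"
    by (rule schur_setting.schur_eqI[OF schur_setting_rect_hsum[OF assms(1,2)], of _ v])
      (simp_all add: assms rect_hsum_def)
  then show ?thesis
    using assms(3-8) by (simp add: rect_hglue_def rect_space_def cat_mem uncat_cat)
qed

lemma rect_vglue_eqI:
  fixes M M' :: "('a::{real_inner, complete_space}, 'b::{real_inner, complete_space}) rect_vec \<Rightarrow> ('a, 'b) rect_vec"
  assumes "coercive_op (rect_space p q) M" "coercive_op (rect_space p q') M'"
    and "s \<in> seg p" "n \<in> seg p" "w \<in> seg q" "w' \<in> seg q'" "e \<in> seg q" "e' \<in> seg q'" "v \<in> seg p"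
    and "M (s, v, w, e) = (ys, m, yw, ye)" "M' (v, n, w', e') = (- m, yn, yw', ye')"
  shows "rect_vglue p q q' M M' (s, n, cat q (w, w'), cat q (e, e')) =
    (ys, yn, cat q (yw, yw'), cat q (ye, ye'))"
proof -
  have "schur (seg p) (rect_vsum M M') (s, n, (w, w'), (e, e')) = (ys, yn, (yw, yw'), (ye, ye'))"
    by (rule schur_setting.schur_eqI[OF schur_setting_rect_vsum[OF assms(1,2)], of _ v])
      (simp_all add: assms rect_vsum_def)
  then show ?thesis
    using assms(3-8) by (simp add: rect_vglue_def rect_space_def cat_mem uncat_cat)
qed

lemma half_vglue_eqI:
  fixes M M' :: "('a::{real_inner, complete_space}, 'b::{real_inner, complete_space}) half_vec \<Rightarrow> ('a, 'b) half_vec"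
  assumes "coercive_op (half_space q) M" "coercive_op (half_space q') M'"
    and "s \<in> half_line" "n \<in> half_line" "e \<in> seg q" "e' \<in> seg q'" "v \<in> half_line"
    and "M (s, v, e) = (ys, m, ye)" "M' (v, n, e') = (- m, yn, ye')"
  shows "half_vglue q q' M M' (s, n, cat q (e, e')) = (ys, yn, cat q (ye, ye'))"
proof -
  have "schur half_line (half_vsum M M') (s, n, (e, e')) = (ys, yn, (ye, ye'))"
    by (rule schur_setting.schur_eqI[OF schur_setting_half_vsum[OF assms(1,2)], of _ v])
      (simp_all add: assms half_vsum_def)
  then show ?thesis
    using assms(3-6) by (simp add: half_vglue_def half_space_def cat_mem uncat_cat)
qed

text \<open>Only gluings that involve half-strips are ever taken apart: the arguments below open the
  known values of \<open>B\<close> and assemble rectangle gluings from the pieces.\<close>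

lemma half_vglue_obtain:
  fixes M M' :: "('a::{real_inner, complete_space}, 'b::{real_inner, complete_space}) half_vec \<Rightarrow> ('a, 'b) half_vec"
  assumes "coercive_op (half_space q) M" "coercive_op (half_space q') M'"
    and "s \<in> half_line" "n \<in> half_line" "e \<in> seg q" "e' \<in> seg q'"
  obtains v ys yn m ye ye' where "v \<in> half_line"
    "M (s, v, e) = (ys, m, ye)" "M' (v, n, e') = (- m, yn, ye')"
    "half_vglue q q' M M' (s, n, cat q (e, e')) = (ys, yn, cat q (ye, ye'))"
proof -
  have "(s, n, (e, e')) \<in> half_line \<times> half_line \<times> (seg q \<times> seg q')" using assms by simp
  then obtain v where v: "v \<in> half_line" "half_vsum M M' ((s, n, (e, e')), v) =
      (schur half_line (half_vsum M M') (s, n, (e, e')), 0)"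
    using schur_setting.schur_ex[OF schur_setting_half_vsum[OF assms(1,2)]] by blast
  obtain ys m ye where M: "M (s, v, e) = (ys, m, ye)" by (metis prod_cases3)
  obtain m' yn ye' where M': "M' (v, n, e') = (m', yn, ye')" by (metis prod_cases3)
  have "m' = - m" using v(2) by (simp add: half_vsum_def M M' eq_neg_iff_add_eq_0 add.commute)
  then show thesis using that v(1) M M' half_vglue_eqI[OF assms v(1) M] by blast
qed

lemma half_hglue_eqI:
  fixes M :: "('a::{real_inner, complete_space}, 'b::{real_inner, complete_space}) half_vec \<Rightarrow> ('a, 'b) half_vec"
    and P :: "('a, 'b) rect_vec \<Rightarrow> ('a, 'b) rect_vec"
  assumes "coercive_op (half_space q) M" "coercive_op (rect_space p q) P"
    and "s \<in> half_line" "s' \<in> seg p" "n \<in> half_line" "n' \<in> seg p" "e \<in> seg q" "v \<in> seg q"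
    and "M (s, n, v) = (ys, yn, m)" "P (s', n', v, e) = (ys', yn', - m, ye)"
  shows "half_hglue p q M P (DL p (s, s'), DL p (n, n'), e) = (DL p (ys, ys'), DL p (yn, yn'), ye)"
proof -
  have "schur (seg q) (half_hsum M P) ((s, s'), (n, n'), e) = ((ys, ys'), (yn, yn'), ye)"
    by (rule schur_setting.schur_eqI[OF schur_setting_half_hsum[OF assms(1,2)], of _ v])
      (simp_all add: assms half_hsum_def)
  then show ?thesis
    using assms(3-7) by (simp add: half_hglue_def half_space_def DL_mem DL_adj_DL)
qed

lemma half_hglue_obtain:
  fixes M :: "('a::{real_inner, complete_space}, 'b::{real_inner, complete_space}) half_vec \<Rightarrow> ('a, 'b) half_vec"
    and P :: "('a, 'b) rect_vec \<Rightarrow> ('a, 'b) rect_vec"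
  assumes "coercive_op (half_space q) M" "coercive_op (rect_space p q) P"
    and "s \<in> half_line" "s' \<in> seg p" "n \<in> half_line" "n' \<in> seg p" "e \<in> seg q"
  obtains v ys yn m ys' yn' ye where "v \<in> seg q"
    "M (s, n, v) = (ys, yn, m)" "P (s', n', v, e) = (ys', yn', - m, ye)"
    "half_hglue p q M P (DL p (s, s'), DL p (n, n'), e) = (DL p (ys, ys'), DL p (yn, yn'), ye)"
proof -
  have "((s, s'), (n, n'), e) \<in> (half_line \<times> seg p) \<times> (half_line \<times> seg p) \<times> seg q" using assms by simp
  then obtain v where v: "v \<in> seg q" "half_hsum M P (((s, s'), (n, n'), e), v) =
      (schur (seg q) (half_hsum M P) ((s, s'), (n, n'), e), 0)"
    using schur_setting.schur_ex[OF schur_setting_half_hsum[OF assms(1,2)]] by blast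
  obtain ys yn m where M: "M (s, n, v) = (ys, yn, m)" by (metis prod_cases3)
  obtain ys' yn' m' ye where P: "P (s', n', v, e) = (ys', yn', m', ye)" by (metis prod_cases4)
  have "m' = - m" using v(2) by (simp add: half_hsum_def M P eq_neg_iff_add_eq_0 add.commute)
  then show thesis using that v(1) M P half_hglue_eqI[OF assms v(1) M] by blast
qed

lemma coercive_op_half_memD:
  "coercive_op (half_space q) M \<Longrightarrow> s \<in> half_line \<Longrightarrow> n \<in> half_line \<Longrightarrow> e \<in> seg q \<Longrightarrow>
    M (s, n, e) = (ys, yn, ye) \<Longrightarrow> ys \<in> half_line \<and> yn \<in> half_line \<and> ye \<in> seg q"
  unfolding coercive_op_def half_space_def using linear_sqs_mem by fastforce

lemma coercive_op_rect_memD: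
  "coercive_op (rect_space p q) M \<Longrightarrow> s \<in> seg p \<Longrightarrow> n \<in> seg p \<Longrightarrow> w \<in> seg q \<Longrightarrow> e \<in> seg q \<Longrightarrow>
    M (s, n, w, e) = (ys, yn, yw, ye) \<Longrightarrow> ys \<in> seg p \<and> yn \<in> seg p \<and> yw \<in> seg q \<and> ye \<in> seg q"
  unfolding coercive_op_def rect_space_def using linear_sqs_mem by fastforce

section \<open>The shift, associativity and interchange\<close>

lemma DL_obtain:
  assumes "w \<in> half_line"
  obtains u h where "u \<in> half_line" "h \<in> seg p" "w = DL p (u, h)"
  using DL_DL_adj[OF assms, of p] DL_adj_mem[OF assms, of p] by (metis mem_Times_iff prod.collapse)

text \<open>The segment attached last lies nearest to the East end, so \<open>h'\<close> comes
  second in \<open>cat\<close>.\<close>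

lemma DL_DL: "h' \<in> seg p' \<Longrightarrow> DL p' (DL p (w, h), h') = DL (p + p') (w, cat p (h, h'))"
  by (auto simp: DL_def cat_def fun_eq_iff nat_add_distrib add_ac intro!: arg_cong[of _ _ w] arg_cong[of _ _ h] arg_cong[of _ _ h'])

lemma DL_minus: "DL p (- w, - h) = - DL p (w, h :: nat \<Rightarrow> 'a::real_inner)"
  by (auto simp: DL_def fun_eq_iff)

lemma DL_inject:
  assumes "DL p (w, h) = DL p (w', h')" "w \<in> half_line" "w' \<in> half_line" "h \<in> seg p" "h' \<in> seg p"
  shows "w = w' \<and> h = h'"
  using assms DL_adj_DL by (metis Pair_inject)

text \<open>Specialises \<open>(B|R)|Q = B|(R|Q)\<close>. Since \<open>B|R\<close> is
  \<open>B\<close> itself, the value of \<open>B\<close> found while opening \<open>B|Q\<close> can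
  be opened once more through \<open>R\<close>.\<close>

lemma half_hglue_assoc_fixed:
  fixes B :: "('a::{real_inner, complete_space}, 'b::{real_inner, complete_space}) half_vec \<Rightarrow> ('a, 'b) half_vec"
  assumes B: "coercive_op (half_space q) B" and R: "coercive_op (rect_space p q) R"
    and Q: "coercive_op (rect_space p' q) Q"
    and BR: "half_hglue p q B R = B" and BQ: "half_hglue p' q B Q = B"
  shows "half_hglue (p + p') q B (rect_hglue p p' q R Q) = B"
proof
  fix x
  show "half_hglue (p + p') q B (rect_hglue p p' q R Q) x = B x"
  proof (cases "x \<in> half_space q")
    case False
    \<comment> \<open>Off the carrier both sides are \<open>undefined\<close>, \<open>B\<close>
      because it equals a gluing.\<close>
    then show ?thesis by (subst BR[symmetric]) (simp add: half_hglue_def)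
  next
    case True
    then obtain s n e where x: "x = (s, n, e)" "s \<in> half_line" "n \<in> half_line" "e \<in> seg q"
      by (auto simp: half_space_def)
    \<comment> \<open>The \<open>p'\<close> coordinates nearest to the East end face
      \<open>Q\<close>, the next \<open>p\<close> face \<open>R\<close>.\<close>
    obtain s1 s' where s: "s1 \<in> half_line" "s' \<in> seg p'" "s = DL p' (s1, s')" using DL_obtain[OF x(2)] .
    obtain s2 s'' where s1: "s2 \<in> half_line" "s'' \<in> seg p" "s1 = DL p (s2, s'')" using DL_obtain[OF s(1)] .
    obtain n1 n' where n: "n1 \<in> half_line" "n' \<in> seg p'" "n = DL p' (n1, n')" using DL_obtain[OF x(3)] .
    obtain n2 n'' where n1: "n2 \<in> half_line" "n'' \<in> seg p" "n1 = DL p (n2, n'')" using DL_obtain[OF n(1)] .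
    obtain v ys yn m ys' yn' ye where v: "v \<in> seg q" "B (s1, n1, v) = (ys, yn, m)"
      "Q (s', n', v, e) = (ys', yn', - m, ye)"
      "half_hglue p' q B Q (DL p' (s1, s'), DL p' (n1, n'), e) = (DL p' (ys, ys'), DL p' (yn, yn'), ye)"
      using half_hglue_obtain[OF B Q s(1,2) n(1,2) x(4)] .
    obtain u zs zn l zs' zn' ze where u: "u \<in> seg q" "B (s2, n2, u) = (zs, zn, l)"
      "R (s'', n'', u, v) = (zs', zn', - l, ze)"
      "half_hglue p q B R (DL p (s2, s''), DL p (n2, n''), v) = (DL p (zs, zs'), DL p (zn, zn'), ze)"
      using half_hglue_obtain[OF B R s1(1,2) n1(1,2) v(1)] .
    \<comment> \<open>Both computations end in the same value \<open>B (s1, n1, v)\<close>. In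
      particular the response of \<open>B\<close> towards \<open>Q\<close> is the East output of
      \<open>R\<close>, which is what the gluing of \<open>R\<close> and \<open>Q\<close>
      needs.\<close>
    have eq: "ys = DL p (zs, zs')" "yn = DL p (zn, zn')" "m = ze"
      using u(4) v(2) by (simp_all add: BR s1 n1)
    have "rect_hglue p p' q R Q (cat p (s'', s'), cat p (n'', n'), u, e) =
        (cat p (zs', ys'), cat p (zn', yn'), - l, ye)"
      using v(3) by (intro rect_hglue_eqI[OF R Q s1(2) s(2) n1(2) n(2) u(1) x(4) v(1) u(3)]) (simp add: eq)
    then have "half_hglue (p + p') q B (rect_hglue p p' q R Q)
        (DL (p + p') (s2, cat p (s'', s')), DL (p + p') (n2, cat p (n'', n')), e) =
      (DL (p + p') (zs, cat p (zs', ys')), DL (p + p') (zn, cat p (zn', yn')), ye)"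
      using s s1 n n1 x(4) u(1,2)
      by (intro half_hglue_eqI[OF B coercive_op_rect_hglue[OF R Q]]) (auto simp: cat_mem)
    moreover have "ys' \<in> seg p'" "yn' \<in> seg p'"
      using coercive_op_rect_memD[OF Q s(2) n(2) v(1) x(4) v(3)] by auto
    ultimately show ?thesis
      using v(4) by (simp add: BQ DL_DL[symmetric] x s n s1 n1 eq)
  qed
qed

text \<open>Interchange law for the 2 by 2 arrangement with \<open>B\<close>, \<open>G\<close> below
  and \<open>B'\<close>, \<open>G'\<close> above. The stack is opened along its horizontal seam,
  then each layer along its vertical seam, with \<open>B\<close> and \<open>B'\<close> standing for
  \<open>B|G\<close> and \<open>B'|G'\<close>; the four pieces are reassembled in the other
  order.\<close>

lemma half_hglue_vglue_fixed:
  fixes B :: "('a::{real_inner, complete_space}, 'b::{real_inner, complete_space}) half_vec \<Rightarrow> ('a, 'b) half_vec"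
  assumes B: "coercive_op (half_space q) B" and B': "coercive_op (half_space q') B'"
    and G: "coercive_op (rect_space p q) G" and G': "coercive_op (rect_space p q') G'"
    and BG: "half_hglue p q B G = B" and BG': "half_hglue p q' B' G' = B'"
  shows "half_hglue p (q + q') (half_vglue q q' B B') (rect_vglue p q q' G G') = half_vglue q q' B B'"
proof
  fix x
  show "half_hglue p (q + q') (half_vglue q q' B B') (rect_vglue p q q' G G') x = half_vglue q q' B B' x"
  proof (cases "x \<in> half_space (q + q')")
    case False
    then show ?thesis by (simp add: half_hglue_def half_vglue_def)
  next
    case True
    then obtain s n f where x: "x = (s, n, f)" "s \<in> half_line" "n \<in> half_line" "f \<in> seg (q + q')"
      by (auto simp: half_space_def)
    obtain e e' where e: "e \<in> seg q" "e' \<in> seg q'" "f = cat q (e, e')"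
      using cat_uncat[of q f] uncat_mem[OF x(4)] by (metis mem_Times_iff prod.collapse)
    obtain v ys yn m ye ye' where v: "v \<in> half_line" "B (s, v, e) = (ys, m, ye)"
      "B' (v, n, e') = (- m, yn, ye')" "half_vglue q q' B B' (s, n, cat q (e, e')) = (ys, yn, cat q (ye, ye'))"
      using half_vglue_obtain[OF B B' x(2,3) e(1,2)] .
    obtain s1 s' where s: "s1 \<in> half_line" "s' \<in> seg p" "s = DL p (s1, s')" using DL_obtain[OF x(2)] .
    obtain n1 n' where n: "n1 \<in> half_line" "n' \<in> seg p" "n = DL p (n1, n')" using DL_obtain[OF x(3)] .
    \<comment> \<open>The seam value splits like the outer sides: \<open>v1\<close> lives between
      \<open>B\<close> and \<open>B'\<close>, \<open>v'\<close> between \<open>G\<close> and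
      \<open>G'\<close>.\<close>
    obtain v1 v' where v1: "v1 \<in> half_line" "v' \<in> seg p" "v = DL p (v1, v')" using DL_obtain[OF v(1)] .
    obtain t zs zm k zs' zm' ze where t: "t \<in> seg q" "B (s1, v1, t) = (zs, zm, k)"
      "G (s', v', t, e) = (zs', zm', - k, ze)"
      "half_hglue p q B G (DL p (s1, s'), DL p (v1, v'), e) = (DL p (zs, zs'), DL p (zm, zm'), ze)"
      using half_hglue_obtain[OF B G s(1,2) v1(1,2) e(1)] .
    obtain u xm zn l xm' zn' xe where u: "u \<in> seg q'" "B' (v1, n1, u) = (xm, zn, l)"
      "G' (v', n', u, e') = (xm', zn', - l, xe)"
      "half_hglue p q' B' G' (DL p (v1, v'), DL p (n1, n'), e') = (DL p (xm, xm'), DL p (zn, zn'), xe)"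
      using half_hglue_obtain[OF B' G' v1(1,2) n(1,2) e(2)] .
    have eq: "ys = DL p (zs, zs')" "m = DL p (zm, zm')" "ye = ze"
      using t(4) v(2) by (simp_all add: BG s v1)
    have eq': "- m = DL p (xm, xm')" "yn = DL p (zn, zn')" "ye' = xe"
      using u(4) v(3) by (simp_all add: BG' n v1)
    \<comment> \<open>The responses cancel on the long seam; by injectivity of the shift they cancel
      separately on its half-line part and on its segment.\<close>
    have "DL p (xm, xm') = DL p (- zm, - zm')"
      using eq(2) eq'(1) by (simp add: DL_minus)
    moreover have "zm \<in> half_line" "zm' \<in> seg p" "xm \<in> half_line" "xm' \<in> seg p"
      using coercive_op_half_memD[OF B s(1) v1(1) t(1,2)] coercive_op_rect_memD[OF G s(2) v1(2) t(1) e(1) t(3)]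
        coercive_op_half_memD[OF B' v1(1) n(1) u(1,2)] coercive_op_rect_memD[OF G' v1(2) n(2) u(1) e(2) u(3)]
      by auto
    ultimately have xm: "xm = - zm" "xm' = - zm'"
      using DL_inject[of p xm xm' "- zm" "- zm'"] by (simp_all add: closed_simps)
    have half: "half_vglue q q' B B' (s1, n1, cat q (t, u)) = (zs, zn, cat q (k, l))"
      using u(2) by (intro half_vglue_eqI[OF B B' s(1) n(1) t(1) u(1) v1(1) t(2)]) (simp add: xm)
    have "rect_vglue p q q' G G' (s', n', cat q (t, u), cat q (e, e')) =
        (zs', zn', cat q (- k, - l), cat q (ze, xe))"
      using u(3) by (intro rect_vglue_eqI[OF G G' s(2) n(2) t(1) u(1) e(1,2) v1(2) t(3)]) (simp add: xm)
    moreover have "cat q (- k, - l) = - cat q (k, l)"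
      by (auto simp: cat_def fun_eq_iff)
    ultimately have "half_hglue p (q + q') (half_vglue q q' B B') (rect_vglue p q q' G G')
        (DL p (s1, s'), DL p (n1, n'), cat q (e, e')) = (DL p (zs, zs'), DL p (zn, zn'), cat q (ze, xe))"
      using s n e t(1) u(1) half
      by (intro half_hglue_eqI[OF coercive_op_half_vglue[OF B B'] coercive_op_rect_vglue[OF G G'],
            where v = "cat q (t, u)" and m = "cat q (k, l)"]) (auto simp: cat_mem)
    then show ?thesis
      using v(4) by (simp add: x e s n eq eq')
  qed
qed

section \<open>Rows, grids and stacks\<close>

lemma coercive_op_row:
  fixes Q :: "('a::{real_inner, complete_space}, 'b::{real_inner, complete_space}) rect_vec \<Rightarrow> ('a, 'b) rect_vec"
  assumes "coercive_op (rect_space 1 1) Q" "p \<ge> 1"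
  shows "coercive_op (rect_space p 1) (row Q p)"
  using assms(2)
\<comment> \<open>The induction starts at 1, as \<open>row Q 0\<close> is
  \<open>undefined\<close>.\<close>
proof (induction p rule: dec_induct)
  case (step p)
  then show ?case using coercive_op_rect_hglue[OF step.IH assms(1)] by simp
qed (use assms in simp)

lemma coercive_op_grid:
  fixes Q :: "('a::{real_inner, complete_space}, 'b::{real_inner, complete_space}) rect_vec \<Rightarrow> ('a, 'b) rect_vec"
  assumes "coercive_op (rect_space 1 1) Q" "p \<ge> 1" "q \<ge> 1"
  shows "coercive_op (rect_space p q) (grid Q p q)"
  using assms(3)
proof (induction q rule: dec_induct)
  case (step q)
  then show ?case using coercive_op_rect_vglue[OF step.IH coercive_op_row[OF assms(1,2)]] by simp
qed (use coercive_op_row[OF assms(1,2)] in simp)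

lemma coercive_op_half_stack:
  fixes B :: "('a::{real_inner, complete_space}, 'b::{real_inner, complete_space}) half_vec \<Rightarrow> ('a, 'b) half_vec"
  assumes "coercive_op (half_space 1) B" "q \<ge> 1"
  shows "coercive_op (half_space q) (half_stack B q)"
  using assms(2)
proof (induction q rule: dec_induct)
  case (step q)
  then show ?case using coercive_op_half_vglue[OF step.IH assms(1)] by simp
qed (use assms in simp)

text \<open>A grid is a stack of rows: associativity absorbs one whole row into \<open>B\<close>,
  and interchange then absorbs the rows of the grid into the copies of \<open>B\<close>.\<close>

lemma half_hglue_grid:
  fixes B :: "('a::{real_inner, complete_space}, 'b::{real_inner, complete_space}) half_vec \<Rightarrow> ('a, 'b) half_vec"
  assumes B: "coercive_op (half_space 1) B" and Q: "coercive_op (rect_space 1 1) Q"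
    and BQ: "half_hglue 1 1 B Q = B" and p: "p \<ge> 1" and q: "q \<ge> 1"
  shows "half_hglue p q (half_stack B q) (grid Q p q) = half_stack B q"
proof -
  have row: "half_hglue p 1 B (row Q p) = B"
    using p
  proof (induction p rule: dec_induct)
    case (step p)
    then show ?case
      using half_hglue_assoc_fixed[OF B coercive_op_row[OF Q step(1)] Q step.IH BQ] by simp
  qed (use BQ in simp)
  show ?thesis
    using q
  proof (induction q rule: dec_induct)
    case (step q)
    then show ?case
      using half_hglue_vglue_fixed[OF coercive_op_half_stack[OF B step(1)] B
          coercive_op_grid[OF Q p step(1)] coercive_op_row[OF Q p] step.IH row] by simp
  qed (use row in simp)
qed

subsection \<open>Finite dimension over the scalar field\<close>

text \<open>\<open>re_part\<close> is known only through \<open>add_conjg\<close>, so the identity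
  is proved for the doubled value inside \<open>'k\<close> and pulled back along the injection
  \<open>of_real\<close>.\<close>

lemma re_part_add: "re_part (x + y) = re_part x + re_part (y :: 'k::real_or_complex)"
proof -
  have "(of_real (2 * re_part (x + y)) :: 'k) = of_real (2 * (re_part x + re_part y))"
  proof -
    have "(x + y) + conjg (x + y) = (x + conjg x) + (y + conjg y)"
      by (simp add: conjg_add)
    then show ?thesis
      by (simp only: add_conjg scaleR_conv_of_real mult_1_right distrib_left of_real_add)
  qed
  then show ?thesis by (simp only: of_real_eq_iff) simp
qed

text \<open>Continuity is what moves \<open>re_part\<close> inside the infinite sum of
  \<open>seq_ip\<close>.\<close>

lemma bounded_linear_re_part: "bounded_linear (re_part :: 'k::real_or_complex \<Rightarrow> real)"
proof
  fix x y :: 'k and r :: real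
  show "re_part (x + y) = re_part x + re_part y" by (rule re_part_add)
  have "(of_real (2 * re_part (r *\<^sub>R x)) :: 'k) = of_real (2 * (r * re_part x))"
    using add_conjg[of "r *\<^sub>R x"] arg_cong[OF add_conjg[of x], of "\<lambda>z. of_real r * z"]
    by (simp add: conjg_mult scaleR_conv_of_real algebra_simps)
  then show "re_part (r *\<^sub>R x) = r *\<^sub>R re_part x" by (simp only: of_real_eq_iff) simp
  have "norm (re_part z) \<le> norm z * 1" for z :: 'k
  proof -
    have "2 * norm (re_part z) = norm (z + conjg z)"
      unfolding add_conjg by simp
    also have "\<dots> \<le> norm z + norm z"
      using norm_triangle_ineq[of z "conjg z"] by simp
    finally show ?thesis by simp
  qed
  then show "\<exists>K. \<forall>z::'k. norm (re_part z) \<le> norm z * K" by blast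
qed

text \<open>All \<open>z - re_part z\<close> have square \<open>- \<bar>z - re_part z\<bar>\<^sup>2\<close>, so they are real multiples of each other.\<close>

lemma real_or_complex_generator: "\<exists>u::'k::real_or_complex. \<forall>z. \<exists>a b. z = of_real a + of_real b * u"
proof -
  define im :: "'k \<Rightarrow> 'k" where "im z = z - of_real (re_part z)" for z
  have conjg_im: "conjg (im z) = - im z" for z
  proof -
    have "conjg (z + of_real (- re_part z)) = conjg z - of_real (re_part z)"
      by (simp only: conjg_add conjg_of_real) simp
    moreover have "conjg z = 2 * of_real (re_part z) - z"
      using add_conjg[of z] by (simp add: scaleR_conv_of_real algebra_simps)
    ultimately show ?thesis by (simp add: im_def)
  qed
  have sq: "im z * im z = - (of_real ((norm (im z))\<^sup>2))" for z
    using mult_conjg[of "im z"] by (simp add: conjg_im scaleR_conv_of_real minus_equation_iff[of "im z * im z"])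
  show ?thesis
  proof (cases "\<forall>z. im z = 0")
    case True
    then have "z = of_real (re_part z) + of_real 0 * 0" for z :: 'k
      using True[rule_format, of z] unfolding im_def by simp
    then show ?thesis by blast
  next
    case False
    then obtain z0 where z0: "im z0 \<noteq> 0" by blast
    \<comment> \<open>Scaled to a square root of -1; a field has at most two of these, and they are
      opposite.\<close>
    define nrm where "nrm z = im z / of_real (norm (im z))" for z
    have nrm: "nrm z * nrm z = - 1" if "im z \<noteq> 0" for z
      using sq[of z] that by (simp add: nrm_def power2_eq_square field_simps)
    have "\<exists>a b. z = of_real a + of_real b * nrm z0" for z
    proof (cases "im z = 0")
      case True
      then have "z = of_real (re_part z) + of_real 0 * nrm z0" by (simp add: im_def)
      then show ?thesis by blast
    next
      case False
      then have "nrm z * nrm z = nrm z0 * nrm z0" using nrm z0 by simp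
      then have "nrm z = nrm z0 \<or> nrm z = - nrm z0" by (simp add: square_eq_iff)
      moreover have "z = of_real (re_part z) + of_real (norm (im z)) * nrm z"
        using False by (simp add: nrm_def) (simp add: im_def)
      ultimately have "z = of_real (re_part z) + of_real (norm (im z)) * nrm z0 \<or>
          z = of_real (re_part z) + of_real (- norm (im z)) * nrm z0" by auto
      then show ?thesis by blast
    qed
    then show ?thesis by blast
  qed
qed

text \<open>The class-level inner product sees real combinations only, whereas
  \<open>finite_dim\<close> speaks of \<open>'k\<close>. A spanning set over \<open>'k\<close>
  together with its multiples by the generator \<open>u\<close> spans over the reals.\<close>

lemma fd_hilbert_finite_real_span:
  fixes sc :: "'k::real_or_complex \<Rightarrow> 'a::{real_inner, complete_space} \<Rightarrow> 'a"
  assumes "fd_hilbert sc ip"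
  shows "\<exists>A::'a set. finite A \<and> span A = UNIV"
proof -
  interpret H: fd_hilbert sc ip by fact
  obtain u :: 'k where u: "\<And>z. \<exists>a b. z = of_real a + of_real b * u"
    using real_or_complex_generator by metis
  obtain A where A: "finite A" "H.span A = UNIV" using H.finite_dim by blast
  have "x \<in> span (A \<union> sc u ` A)" for x
  proof -
    have "x \<in> H.span A" using A by simp
    then show ?thesis
    proof (induction rule: H.span_induct_alt)
      case base
      show ?case by (rule span_zero)
    next
      case (step c x y)
      obtain a b where "c = of_real a + of_real b * u" using u by blast
      then have "sc c x = a *\<^sub>R x + b *\<^sub>R sc u x"
        by (simp add: H.scale_left_distrib H.sc_of_real flip: H.scale_scale)
      then show ?case
        using step by (metis UnCI imageI span_add span_base span_scale)
    qed
  qed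
  then show ?thesis using A(1) by (intro exI[of _ "A \<union> sc u ` A"]) auto
qed

text \<open>Through this instance \<open>DL_adjoint\<close> becomes a statement about
  \<open>rip\<close>.\<close>

lemma fd_hilbert_inner:
  fixes sc :: "'k::real_or_complex \<Rightarrow> 'a::{real_inner, complete_space} \<Rightarrow> 'a"
  assumes "fd_hilbert sc ip"
  shows "fd_hilbert (*\<^sub>R) ((\<bullet>) :: 'a \<Rightarrow> 'a \<Rightarrow> real)"
proof (intro fd_hilbert.intro fd_hilbert_axioms.intro)
  show "vector_space ((*\<^sub>R) :: real \<Rightarrow> 'a \<Rightarrow> 'a)" by (rule real_vector.vector_space_axioms)
  show "\<exists>A::'a set. finite A \<and> module.span (*\<^sub>R) A = UNIV"
    using fd_hilbert_finite_real_span[OF assms] by (simp add: span_raw_def)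
qed (auto simp: inner_add_right inner_commute conjg_real_def power2_norm_eq_inner)

lemma finite_span_prod:
  assumes "\<exists>A::'a::real_vector set. finite A \<and> span A = UNIV" "\<exists>B::'b::real_vector set. finite B \<and> span B = UNIV"
  shows "\<exists>C::('a \<times> 'b) set. finite C \<and> span C = UNIV"
proof -
  obtain A :: "'a set" where A: "finite A" "span A = UNIV" using assms by blast
  obtain B :: "'b set" where B: "finite B" "span B = UNIV" using assms by blast
  define C where "C = (\<lambda>a. (a, 0)) ` A \<union> (\<lambda>b. (0, b)) ` B"
  have "linear (\<lambda>a::'a. (a, 0::'b))" "linear (\<lambda>b::'b. (0::'a, b))" by (auto intro!: linearI)
  from linear_span_image[OF this(1), of A] linear_span_image[OF this(2), of B]
  have "(x, 0) \<in> span C" "(0, y) \<in> span C" for x y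
    using A B span_mono[of "(\<lambda>a. (a, 0)) ` A" C] span_mono[of "(\<lambda>b. (0, b)) ` B" C]
    by (auto simp: C_def)
  from span_add[OF this] have "(x, y) \<in> span C" for x y by simp
  then show ?thesis using A B by (intro exI[of _ C]) (auto simp: C_def)
qed

text \<open>Expand \<open>x\<close> in a basis that is orthonormal for \<open>h\<close>.\<close>

lemma norm_le_positive_definite_form:
  fixes h :: "'x::real_vector \<Rightarrow> 'x \<Rightarrow> real" and f :: "'x \<Rightarrow> 'y::real_normed_vector"
  assumes add: "\<And>x y z. h x (y + z) = h x y + h x z" and scale: "\<And>r x y. h x (r *\<^sub>R y) = r * h x y"
    and commute: "\<And>x y. h x y = h y x" and pos: "\<And>x. x \<noteq> 0 \<Longrightarrow> 0 < h x x"
    and A: "finite A" "span A = (UNIV :: 'x set)" and f: "linear f"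
  shows "\<exists>C. \<forall>x. norm (f x) \<le> C * sqrt (h x x)"
proof -
  have h: "linear (h x)" for x by (rule linearI) (simp_all add: add scale)
  have h_diff: "h x (y - z) = h x y - h x z" for x y z by (rule linear_diff[OF h])
  have h_sum: "h x (\<Sum>g\<in>F. c g *\<^sub>R g) = (\<Sum>g\<in>F. c g * h x g)" for x F c
    by (simp add: linear_sum[OF h] scale)
  \<comment> \<open>Gram--Schmidt for \<open>h\<close>, by induction over the spanning set; a vector
    whose remainder \<open>b\<close> vanishes contributes nothing new.\<close>
  have "\<exists>F::'x set. finite F \<and> A \<subseteq> span F \<and> (\<forall>x\<in>F. \<forall>y\<in>F. h x y = (if x = y then 1 else 0))"
    using A(1)
  proof (induction A rule: finite_induct)
    case (insert a A)
    then obtain F where F: "finite F" "A \<subseteq> span F"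
      and on: "\<And>x y. x \<in> F \<Longrightarrow> y \<in> F \<Longrightarrow> h x y = (if x = y then 1 else 0)" by blast
    define b where "b = a - (\<Sum>g\<in>F. h g a *\<^sub>R g)"
    have orth: "h g b = 0" if "g \<in> F" for g
    proof -
      have "(\<Sum>g'\<in>F. h g' a * h g g') = (\<Sum>g'\<in>F. if g' = g then h g' a else 0)"
        using that by (intro sum.cong) (auto simp: on)
      then show ?thesis using that F(1) by (simp add: b_def h_diff h_sum)
    qed
    have in_span: "(\<Sum>g\<in>F. h g a *\<^sub>R g) \<in> span F"
      by (intro span_sum span_scale span_base)
    show ?case
    proof (cases "b = 0")
      case True
      then have "a \<in> span F" using in_span by (simp add: b_def)
      then show ?thesis using F on by blast
    next
      case False
      define c where "c = (1 / sqrt (h b b)) *\<^sub>R b"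
      have "h b b > 0" using pos False by blast
      then have c1: "h c c = 1" by (simp add: c_def scale commute[of "_ *\<^sub>R _"])
      have c0: "h g c = 0" if "g \<in> F" for g using that by (simp add: c_def scale orth)
      have sub: "span F \<subseteq> span (insert c F)" by (rule span_mono) blast
      have "b = sqrt (h b b) *\<^sub>R c" using \<open>h b b > 0\<close> by (simp add: c_def)
      then have "b \<in> span (insert c F)" by (metis span_scale span_base insertI1)
      then have "b + (\<Sum>g\<in>F. h g a *\<^sub>R g) \<in> span (insert c F)"
        using in_span sub by (intro span_add) auto
      then have "insert a A \<subseteq> span (insert c F)" using F(2) sub by (auto simp: b_def)
      moreover have "\<forall>x\<in>insert c F. \<forall>y\<in>insert c F. h x y = (if x = y then 1 else 0)"
      proof -
        have "c \<notin> F" using c0 c1 by force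
        moreover have "h c g = 0" if "g \<in> F" for g using c0[OF that] commute[of c g] by simp
        ultimately show ?thesis using c0 c1 on by (simp add: ball_Un) (metis c0)
      qed
      ultimately show ?thesis using F(1) by (intro exI[of _ "insert c F"]) simp
    qed
  qed auto
  then obtain F where F: "finite F" "A \<subseteq> span F"
    and on: "\<And>x y. x \<in> F \<Longrightarrow> y \<in> F \<Longrightarrow> h x y = (if x = y then 1 else 0)" by blast
  have spanF: "x \<in> span F" for x using A(2) F(2) span_mono span_span by (metis UNIV_I subsetD)
  have expand: "x = (\<Sum>g\<in>F. h g x *\<^sub>R g)" for x
    using spanF[of x]
  proof (induction rule: span_induct_alt)
    case (step r x y)
    have "(\<Sum>g\<in>F. h g x *\<^sub>R g) = (\<Sum>g\<in>F. if g = x then g else 0)"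
      using step(1) by (intro sum.cong) (auto simp: on)
    then have "(\<Sum>g\<in>F. h g x *\<^sub>R g) = x" using step(1) F(1) by simp
    then show ?case
      using step(2) by (simp add: add scale scaleR_add_left sum.distrib flip: scaleR_scaleR scaleR_sum_right)
  qed (simp add: linear_0[OF h])
  \<comment> \<open>Bessel's inequality for a single member of the orthonormal set.\<close>
  have coord: "\<bar>h g x\<bar> \<le> sqrt (h x x)" if "g \<in> F" for g x
  proof -
    have "0 \<le> h z z" for z using pos[of z] linear_0[OF h, of 0] by (cases "z = 0") auto
    then have "0 \<le> h (x - h g x *\<^sub>R g) (x - h g x *\<^sub>R g)" .
    also have "\<dots> = h x x - (h g x)\<^sup>2"
      using on[OF that that] commute[of "x - h g x *\<^sub>R g"] commute[of x g]
      by (simp add: h_diff scale commute[of "x - h g x *\<^sub>R g"] power2_eq_square)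
    finally show ?thesis by (simp add: real_le_rsqrt)
  qed
  have "norm (f x) \<le> (\<Sum>g\<in>F. norm (f g)) * sqrt (h x x)" for x
  proof -
    have "norm (f x) = norm (\<Sum>g\<in>F. h g x *\<^sub>R f g)"
      using arg_cong[OF expand[of x], of f] by (simp add: linear_sum[OF f] linear_scale[OF f])
    also have "\<dots> \<le> (\<Sum>g\<in>F. \<bar>h g x\<bar> * norm (f g))"
      using norm_sum[of "\<lambda>g. h g x *\<^sub>R f g" F] by simp
    also have "\<dots> \<le> (\<Sum>g\<in>F. norm (f g) * sqrt (h x x))"
      by (intro sum_mono) (metis coord mult.commute mult_left_mono norm_ge_zero)
    finally show ?thesis by (simp add: sum_distrib_right)
  qed
  then show ?thesis by blast
qed

subsection \<open>Coercivity of face and half-strip operators\<close>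

text \<open>The bridge from the \<open>'k\<close>-valued inner products of the statement to the real
  ones of the proof.\<close>

lemma re_part_seq_ip:
  assumes "fd_hilbert sc ip" and x: "x \<in> sqs" and y: "y \<in> sqs"
  shows "re_part (seq_ip ip x y) = rip x y"
proof -
  interpret fd_hilbert sc ip by fact
  have sum: "(\<lambda>k. (norm (x k))\<^sup>2 + (norm (y k))\<^sup>2) summable_on UNIV"
    using x y by (intro summable_on_add) (auto simp: sqs_fun_def)
  have "norm (ip (x k) (y k)) \<le> (norm (x k))\<^sup>2 + (norm (y k))\<^sup>2" for k
    using norm_ip_le[of "x k" "y k"] sum_squares_bound[of "norm (x k)" "norm (y k)"]
      mult_nonneg_nonneg[OF norm_ge_zero[of "x k"] norm_ge_zero[of "y k"]] by linarith
  then have "(\<lambda>k. norm (ip (x k) (y k))) summable_on UNIV"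
    by (rule Infinite_Sum.abs_summable_on_comparison_test'[OF sum])
  then have "(\<lambda>k. ip (x k) (y k)) summable_on UNIV" by (rule abs_summable_summable)
  from has_sum_bounded_linear[OF bounded_linear_re_part has_sum_infsum[OF this]]
  show ?thesis by (simp add: seq_ip_def rip_fun_def re_part_ip infsumI o_def)
qed

lemma re_part_rect_ip:
  assumes "fd_hilbert sc1 ip1" "fd_hilbert sc2 ip2" "x \<in> rect_space p q" "y \<in> rect_space p q"
  shows "re_part (rect_ip ip1 ip2 x y) = rip x y"
  using assms by (auto simp: rect_ip_def rect_space_def re_part_add re_part_seq_ip sqs_simps)

lemma re_part_half_ip:
  assumes "fd_hilbert sc1 ip1" "fd_hilbert sc2 ip2" "x \<in> half_space q" "y \<in> half_space q"
  shows "re_part (half_ip ip1 ip2 x y) = rip x y"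
  using assms by (auto simp: half_ip_def half_space_def re_part_add re_part_seq_ip sqs_simps)

lemma fd_hilbert_comp_of_real: "fd_hilbert sc ip \<Longrightarrow> sc (of_real r) \<circ> f = rscale r f"
  by (auto simp: rscale_fun_def fd_hilbert.sc_of_real)

lemma lin_ops_linear_sqs:
  assumes "M \<in> lin_ops X sc" "\<And>r x. sc (of_real r) x = rscale r x"
  shows "linear_sqs X X M"
  using assms(1) unfolding lin_ops_def linear_sqs_def assms(2)[symmetric] by blast

lemma half_ops_coercive:
  fixes B :: "('a::{real_inner, complete_space}, 'b::{real_inner, complete_space}) half_vec \<Rightarrow> ('a, 'b) half_vec"
  assumes H: "fd_hilbert sc1 ip1" "fd_hilbert sc2 ip2" and B: "B \<in> half_ops sc1 ip1 sc2 ip2 q"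
  shows "coercive_op (half_space q) B" "symmetric_op (half_space q) B"
proof -
  let ?X = "half_space q :: ('a, 'b) half_vec set"
  have lin: "linear_sqs ?X ?X B"
    by (rule lin_ops_linear_sqs[of _ _ "half_scale sc1 sc2"])
      (use B H in \<open>auto simp: half_ops_def half_scale_def fd_hilbert_comp_of_real\<close>)
  note mem = linear_sqs_mem[OF lin] and re = re_part_half_ip[OF H]
  have sqs: "x \<in> sqs" if "x \<in> ?X" for x using that by (rule subspace_sqs_imp_sqs[rotated]) simp
  have "bounded_on ?X (half_ip ip1 ip2) B" using B by (simp add: half_ops_def)
  then obtain C where C: "\<forall>x\<in>?X. sqrt (rip (B x) (B x)) \<le> C * sqrt (rip x x)"
    unfolding bounded_on_def by (metis re mem)
  have "rip (B x) (B x) \<le> C\<^sup>2 * rip x x" if "x \<in> ?X" for x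
    using power_mono[OF C[rule_format, OF that], of 2] by (simp add: power_mult_distrib)
  moreover have "coercive_on ?X (half_ip ip1 ip2) B" using B by (simp add: half_ops_def)
  then obtain c where c: "c > 0" "\<forall>x\<in>?X. x \<noteq> 0 \<longrightarrow> c \<le> rip x (B x) / rip x x"
    unfolding coercive_on_def by (metis re mem)
  have "c * rip x x \<le> rip x (B x)" if x: "x \<in> ?X" for x
  proof (cases "x = 0")
    case True
    then show ?thesis using sqs[OF mem[OF x]] by simp
  next
    case False
    then have "rip x x > 0" using rip_eq_0_imp[OF sqs[OF x]] rip_nonneg[of x] by linarith
    then show ?thesis using c(2)[rule_format, OF x False] by (simp add: pos_le_divide_eq)
  qed
  ultimately show "coercive_op ?X B" using lin c(1) unfolding coercive_op_def by blast
  show "symmetric_op ?X B"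
    unfolding symmetric_op_def
  proof (intro ballI)
    fix x y assume xy: "x \<in> ?X" "y \<in> ?X"
    then have "half_ip ip1 ip2 (B x) y = half_ip ip1 ip2 x (B y)"
      using B by (auto simp: half_ops_def self_adjoint_on_def)
    then show "rip (B x) y = rip x (B y)" using re mem xy by metis
  qed
qed

section \<open>Face operators in finite-dimensional coordinates\<close>

definition unit_vec :: "'a \<Rightarrow> nat \<Rightarrow> 'a::zero" where
  "unit_vec x = (\<lambda>k. if k = 1 then x else 0)"

lemma unit_vec_eq: "f \<in> seg 1 \<Longrightarrow> unit_vec (f 1) = f"
  by (rule ext) (auto simp: seg_def unit_vec_def)

lemma unit_vec_mem [simplified, simp]: "unit_vec x \<in> seg 1"
  by (simp add: seg_def unit_vec_def)

lemma rip_unit_vec: "rip (unit_vec x) (unit_vec y) = x \<bullet> y"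
  by (simp add: rip_seg[OF unit_vec_mem, of x]) (simp add: unit_vec_def)

text \<open>Both constants come from \<open>norm_le_positive_definite_form\<close>. The form of
  \<open>Q\<close> with the identity map gives the lower bound; the inner product with
  \<open>Q\<close> as the map gives the upper bound.\<close>

lemma face_operators_coercive:
  fixes Q :: "('a::{real_inner, complete_space}, 'b::{real_inner, complete_space}) rect_vec \<Rightarrow> ('a, 'b) rect_vec"
  assumes H: "fd_hilbert sc1 ip1" "fd_hilbert sc2 ip2" and Q: "Q \<in> face_operators sc1 ip1 sc2 ip2"
  shows "coercive_op (rect_space 1 1) Q" "symmetric_op (rect_space 1 1) Q"
proof -
  let ?X = "rect_space 1 1 :: ('a, 'b) rect_vec set"
  have lin: "linear_sqs ?X ?X Q"
    by (rule lin_ops_linear_sqs[of _ _ "rect_scale sc1 sc2"])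
      (use Q H in \<open>auto simp: rect_ops_def rect_scale_def fd_hilbert_comp_of_real\<close>)
  note mem = linear_sqs_mem[OF lin] and re = re_part_rect_ip[OF H]
  have sqs: "x \<in> sqs" if "x \<in> ?X" for x using that by (rule subspace_sqs_imp_sqs[rotated]) simp
  have sym: "rip (Q x) y = rip x (Q y)" if xy: "x \<in> ?X" "y \<in> ?X" for x y
  proof -
    have "rect_ip ip1 ip2 (Q x) y = rect_ip ip1 ip2 x (Q y)"
      using Q xy by (auto simp: rect_ops_def self_adjoint_on_def)
    then show "rip (Q x) y = rip x (Q y)" using re mem xy by metis
  qed
  then show "symmetric_op ?X Q" by (simp add: symmetric_op_def)
  have pos: "0 < rip x (Q x)" if "x \<in> ?X" "x \<noteq> 0" for x
    using that Q re mem by (auto simp: rect_ops_def positive_definite_on_def)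
  \<comment> \<open>The carrier is a proper subset of its type, but
    \<open>norm_le_positive_definite_form\<close> needs a form that is definite on a whole
    finite-dimensional type. \<open>E\<close> is an isometry from such a type onto the carrier, and
    \<open>P\<close> is its inverse there.\<close>
  define E :: "'a \<times> 'a \<times> 'b \<times> 'b \<Rightarrow> ('a, 'b) rect_vec"
    where "E = (\<lambda>(s, n, w, e). (unit_vec s, unit_vec n, unit_vec w, unit_vec e))"
  define P :: "('a, 'b) rect_vec \<Rightarrow> 'a \<times> 'a \<times> 'b \<times> 'b"
    where "P = (\<lambda>(s, n, w, e). (s 1, n 1, w 1, e 1))"
  have EX: "E x \<in> ?X" for x by (cases x) (simp add: E_def rect_space_def)
  have EP: "E (P x) = x" if "x \<in> ?X" for x
    using that by (auto simp: E_def P_def rect_space_def unit_vec_eq simp del: One_nat_def)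
  have E_add: "E (x + y) = E x + E y" and E_scale: "E (r *\<^sub>R x) = rscale r (E x)" for x y r
    by (cases x; cases y; auto simp: E_def unit_vec_def fun_eq_iff rscale_fun_def)+
  have E_inj: "E x = 0 \<longleftrightarrow> x = 0" for x
    by (cases x) (auto simp: E_def unit_vec_def fun_eq_iff zero_prod_def)
  have rip_E: "rip (E x) (E y) = x \<bullet> y" for x y
    by (cases x; cases y; auto simp: E_def rip_unit_vec)
  have P: "P (x + y) = P x + P y" "P (rscale r x) = r *\<^sub>R P x" for x y r
    by (cases x; cases y; auto simp: P_def rscale_fun_def)+
  obtain A :: "('a \<times> 'a \<times> 'b \<times> 'b) set" where A: "finite A" "span A = UNIV"
    using finite_span_prod fd_hilbert_finite_real_span H by metis
  have "\<exists>C. \<forall>x. norm x \<le> C * sqrt (rip (E x) (Q (E x)))"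
  proof (rule norm_le_positive_definite_form[where h = "\<lambda>x y. rip (E x) (Q (E y))", OF _ _ _ _ A])
    fix x y z :: "'a \<times> 'a \<times> 'b \<times> 'b" and r :: real
    show "rip (E x) (Q (E (y + z))) = rip (E x) (Q (E y)) + rip (E x) (Q (E z))"
      by (simp add: E_add linear_sqs_add[OF lin EX EX] rip_add_right sqs[OF EX] sqs[OF mem[OF EX]])
    show "rip (E x) (Q (E (r *\<^sub>R y))) = r * rip (E x) (Q (E y))"
      by (simp add: E_scale linear_sqs_rscale[OF lin EX] rip_rscale_right sqs[OF EX] sqs[OF mem[OF EX]])
    show "rip (E x) (Q (E y)) = rip (E y) (Q (E x))"
      using sym[OF EX EX, of x y] by (simp add: rip_commute)
  qed (use pos EX E_inj linear_id in \<open>auto simp: id_def\<close>)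
  then obtain C where C: "\<And>x. norm x \<le> C * sqrt (rip (E x) (Q (E x)))" by blast
  have "linear (\<lambda>x. P (Q (E x)))"
    by (rule linearI) (simp_all only: E_add E_scale P linear_sqs_add[OF lin EX EX] linear_sqs_rscale[OF lin EX])
  then have "\<exists>C. \<forall>x. norm (P (Q (E x))) \<le> C * sqrt (x \<bullet> x)"
    by (intro norm_le_positive_definite_form[where h = "(\<bullet>)", OF _ _ _ _ A])
      (simp_all add: inner_add_right inner_commute)
  then obtain C' where C': "\<And>x. norm (P (Q (E x))) \<le> C' * sqrt (x \<bullet> x)" by blast
  have "rip (Q z) (Q z) \<le> C'\<^sup>2 * rip z z" if "z \<in> ?X" for z
  proof -
    have "(norm (P (Q z)))\<^sup>2 \<le> (C' * sqrt (P z \<bullet> P z))\<^sup>2"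
      using C'[of "P z"] by (intro power_mono) (simp_all add: EP[OF that])
    moreover have "rip (Q z) (Q z) = (norm (P (Q z)))\<^sup>2" "rip z z = P z \<bullet> P z"
      using rip_E[of "P (Q z)" "P (Q z)"] rip_E[of "P z" "P z"]
      by (simp_all add: EP[OF that] EP[OF mem[OF that]] power2_norm_eq_inner)
    ultimately show ?thesis by (simp add: power_mult_distrib)
  qed
  \<comment> \<open>The constant \<open>C\<close> may be 0, for instance on trivial spaces; adding 1
    keeps the divisor positive.\<close>
  moreover have "1 / (C\<^sup>2 + 1) * rip z z \<le> rip z (Q z)" if "z \<in> ?X" for z
  proof -
    have nonneg: "rip z (Q z) \<ge> 0"
      using pos[OF that] sqs[OF mem[OF that]] by (cases "z = 0") auto
    have "(norm (P z))\<^sup>2 \<le> (C * sqrt (rip z (Q z)))\<^sup>2"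
      using C[of "P z"] by (intro power_mono) (simp_all add: EP[OF that])
    moreover have "rip z z = (norm (P z))\<^sup>2"
      using rip_E[of "P z" "P z"] by (simp add: EP[OF that] power2_norm_eq_inner)
    ultimately have "rip z z \<le> C\<^sup>2 * rip z (Q z)"
      using nonneg by (simp add: power_mult_distrib)
    also have "\<dots> \<le> (C\<^sup>2 + 1) * rip z (Q z)"
      using nonneg by (intro mult_right_mono) auto
    finally show ?thesis
      by (simp add: pos_divide_le_eq add_nonneg_pos mult.commute)
  qed
  moreover have "1 / (C\<^sup>2 + 1) > 0" by (simp add: add_nonneg_pos)
  ultimately show "coercive_op ?X Q"
    using lin unfolding coercive_op_def by blast
qed

subsection \<open>The blocks of the glued operator\<close>

lemma rip_DL:
  fixes sc :: "'k::real_or_complex \<Rightarrow> 'a::{real_inner, complete_space} \<Rightarrow> 'a"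
    and w v :: "int \<Rightarrow> 'a" and h :: "nat \<Rightarrow> 'a"
  assumes "fd_hilbert sc ip" and "w \<in> half_line" "h \<in> seg p" "v \<in> half_line"
  shows "rip (DL p (w, h)) v = rip w (fst (DL_adj p v)) + rip h (snd (DL_adj p v))"
  using fd_hilbert.DL_adjoint[OF fd_hilbert_inner[OF assms(1)] assms(2-4)]
  by (simp add: seq_ip_def rip_fun_def)

lemma DL_adj_add: "DL_adj p (v + w) = DL_adj p v + DL_adj p (w :: int \<Rightarrow> 'a::real_inner)"
  by (auto simp: DL_adj_def fun_eq_iff)

lemma DL_add: "DL p (v + w, g + h) = DL p (v, g) + DL p (w, h :: nat \<Rightarrow> 'a::real_inner)"
  by (auto simp: DL_def fun_eq_iff)

lemma DL_adj_zero: "DL_adj p 0 = (0, 0)"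
  by (auto simp: DL_adj_def fun_eq_iff)

lemma half_hglue_add:
  fixes M :: "('a::{real_inner, complete_space}, 'b::{real_inner, complete_space}) half_vec \<Rightarrow> ('a, 'b) half_vec"
    and P :: "('a, 'b) rect_vec \<Rightarrow> ('a, 'b) rect_vec"
  assumes "coercive_op (half_space q) M" "coercive_op (rect_space p q) P"
    and "x \<in> half_space q" "y \<in> half_space q"
  shows "half_hglue p q M P (x + y) = half_hglue p q M P x + half_hglue p q M P y"
proof -
  interpret schur_setting "(half_line \<times> seg p) \<times> (half_line \<times> seg p) \<times> seg q" "seg q" "half_hsum M P"
    by (rule schur_setting_half_hsum[OF assms(1,2)])
  obtain s n e where x: "x = (s, n, e)" by (metis prod_cases3)
  obtain s' n' e' where y: "y = (s', n', e')" by (metis prod_cases3)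
  have mem: "(DL_adj p s, DL_adj p n, e) \<in> (half_line \<times> seg p) \<times> (half_line \<times> seg p) \<times> seg q"
    "(DL_adj p s', DL_adj p n', e') \<in> (half_line \<times> seg p) \<times> (half_line \<times> seg p) \<times> seg q"
    using assms(3,4) DL_adj_mem by (auto simp: x y half_space_def)
  have "x + y \<in> half_space q" using assms(3,4) by (intro subspace_sqs_add) auto
  then show ?thesis
    using assms(3,4) linear_sqs_add[OF schur_linear mem]
    by (simp add: half_hglue_def x y DL_adj_add DL_add split: prod.split)
qed

text \<open>Symmetry passes to the sum and to its Schur complement. By the adjoint relation the
  outer \<open>DL\<close> acts as \<open>DL_adj\<close> on the other argument, so both arguments of
  the pairing are transformed by the same \<open>J\<close>.\<close>

lemma symmetric_op_half_hglue:
  fixes M :: "('a::{real_inner, complete_space}, 'b::{real_inner, complete_space}) half_vec \<Rightarrow> ('a, 'b) half_vec"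
    and P :: "('a, 'b) rect_vec \<Rightarrow> ('a, 'b) rect_vec" and sc :: "'k::real_or_complex \<Rightarrow> 'a \<Rightarrow> 'a"
  assumes H: "fd_hilbert sc ip"
    and M: "coercive_op (half_space q) M" "symmetric_op (half_space q) M"
    and P: "coercive_op (rect_space p q) P" "symmetric_op (rect_space p q) P"
  shows "symmetric_op (half_space q) (half_hglue p q M P)"
proof -
  let ?X = "(half_line \<times> seg p) \<times> (half_line \<times> seg p) \<times> seg q"
  interpret schur_setting ?X "seg q" "half_hsum M P"
    by (rule schur_setting_half_hsum[OF M(1) P(1)])
  have "symmetric_op (?X \<times> seg q) (half_hsum M P)"
  proof (rule overlapping_sum.symmetric_op_sum[OF overlapping_half_hsum _ _ M(2) P(2)])
    show "linear_sqs (half_space q) (half_space q) M" "linear_sqs (rect_space p q) (rect_space p q) P"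
      using M(1) P(1) by (simp_all add: coercive_op_def)
  qed (rule half_hsum_eq)
  then have sym: "symmetric_op ?X (schur (seg q) (half_hsum M P))" by (rule schur_symmetric)
  define J :: "('a, 'b) half_vec \<Rightarrow> _" where "J = (\<lambda>(s, n, e). (DL_adj p s, DL_adj p n, e))"
  have J: "J x \<in> ?X" if "x \<in> half_space q" for x
    using that DL_adj_mem by (auto simp: J_def half_space_def)
  have *: "rip (half_hglue p q M P x) y = rip (schur (seg q) (half_hsum M P) (J x)) (J y)"
    if xy: "x \<in> half_space q" "y \<in> half_space q" for x y
  proof -
    obtain s s' n n' e where S: "schur (seg q) (half_hsum M P) (J x) = ((s, s'), (n, n'), e)"
      by (metis prod.exhaust)
    have "((s, s'), (n, n'), e) \<in> ?X" using linear_sqs_mem[OF schur_linear J[OF xy(1)]] S by simp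
    then show ?thesis
      using xy S by (cases x; cases y) (auto simp: half_hglue_def half_space_def J_def rip_DL[OF H] rip_prod_def)
  qed
  show ?thesis
    unfolding symmetric_op_def
  proof (intro ballI)
    fix x y :: "('a, 'b) half_vec" assume xy: "x \<in> half_space q" "y \<in> half_space q"
    have "rip (half_hglue p q M P x) y = rip (schur (seg q) (half_hsum M P) (J x)) (J y)"
      by (rule *[OF xy])
    also have "\<dots> = rip (schur (seg q) (half_hsum M P) (J y)) (J x)"
      using sym J xy unfolding symmetric_op_def by (metis rip_commute)
    also have "\<dots> = rip x (half_hglue p q M P y)" using *[of y x] xy by (simp add: rip_commute)
    finally show "rip (half_hglue p q M P x) y = rip x (half_hglue p q M P y)" .
  qed
qed

section \<open>Comparison of operators through their blocks\<close>

lemma half_op_eqI: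
  fixes M M' :: "('a::{real_inner, complete_space}, 'b::{real_inner, complete_space}) half_vec \<Rightarrow> ('a, 'b) half_vec"
  assumes mem: "\<And>x. x \<in> half_space q \<Longrightarrow> M x \<in> half_space q" "\<And>x. x \<in> half_space q \<Longrightarrow> M' x \<in> half_space q"
    and add: "\<And>x y. x \<in> half_space q \<Longrightarrow> y \<in> half_space q \<Longrightarrow> M (x + y) = M x + M y"
      "\<And>x y. x \<in> half_space q \<Longrightarrow> y \<in> half_space q \<Longrightarrow> M' (x + y) = M' x + M' y"
    and sym: "symmetric_op (half_space q) M" "symmetric_op (half_space q) M'"
    and ee: "\<And>x. x \<in> seg q \<Longrightarrow> blk_ee M x = blk_ee M' x"
    and he: "\<And>a x. x \<in> seg q \<Longrightarrow> blk_he M a x = blk_he M' a x"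
    and hh: "\<And>a b x. x \<in> half_line \<Longrightarrow> blk_hh M a b x = blk_hh M' a b x"
    and x: "x \<in> half_space q"
  shows "M x = M' x"
proof -
  have eqI: "y = y'" if "\<And>a. h_proj a y = h_proj a y'" "e_proj y = e_proj y'" for y y' :: "('a, 'b) half_vec"
    using that(1)[of South] that(1)[of North] that(2)
    by (cases y; cases y') (simp add: h_proj_def e_proj_def)
  have e_mem: "e_inj e \<in> (half_space q :: ('a, 'b) half_vec set)" if "e \<in> seg q" for e
    using that by (simp add: e_inj_def half_space_def)
  have h_mem: "h_inj b w \<in> (half_space q :: ('a, 'b) half_vec set)" if "w \<in> half_line" for b w
    using that by (cases b) (simp_all add: h_inj_def half_space_def)
  have e: "M (e_inj e) = M' (e_inj e)" if "e \<in> seg q" for e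
    using ee[OF that] he[OF that] by (intro eqI) (simp_all add: blk_ee_def blk_he_def)
  have e_proj: "rip y (e_inj e) = rip (e_proj y) e" if "y \<in> half_space q" for y :: "('a, 'b) half_vec" and e
    using that by (cases y) (simp add: e_inj_def e_proj_def half_space_def sqs_simps)
  have h: "M (h_inj b w) = M' (h_inj b w)" if w: "w \<in> half_line" for b w
  proof (rule eqI)
    show "h_proj a (M (h_inj b w)) = h_proj a (M' (h_inj b w))" for a
      using hh[OF w, of a b] by (simp add: blk_hh_def)
    have "e_proj y \<in> seg q" if "y \<in> half_space q" for y :: "('a, 'b) half_vec"
      using that by (auto simp: e_proj_def half_space_def)
    then have seg: "e_proj (M (h_inj b w)) \<in> seg q" "e_proj (M' (h_inj b w)) \<in> seg q"
      using mem h_mem[OF w] by blast+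
    \<comment> \<open>\<open>e_proj\<close> and \<open>e_inj\<close> are adjoint, so symmetry moves
      the operator onto \<open>e_inj e\<close>, where \<open>M\<close> and \<open>M'\<close> already
      agree.\<close>
    have "rip (e_proj (M (h_inj b w))) e = rip (e_proj (M' (h_inj b w))) e" if "e \<in> seg q" for e
    proof -
      have "rip (e_proj (M (h_inj b w))) e = rip (h_inj b w) (M (e_inj e))"
        using sym(1) mem h_mem[OF w] e_mem[OF that] by (simp add: symmetric_op_def flip: e_proj)
      also have "\<dots> = rip (e_proj (M' (h_inj b w))) e"
        using sym(2) mem h_mem[OF w] e_mem[OF that] e[OF that] by (simp add: symmetric_op_def flip: e_proj)
      finally show ?thesis .
    qed
    then show "e_proj (M (h_inj b w)) = e_proj (M' (h_inj b w))"
      using seg by (intro rip_eq_rightD) (auto simp: sqs_simps)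
  qed
  obtain s n f where sn: "x = (s, n, f)" by (metis prod_cases3)
  have mems: "h_inj South s \<in> (half_space q :: ('a, 'b) half_vec set)"
    "h_inj North n \<in> (half_space q :: ('a, 'b) half_vec set)"
    "e_inj f \<in> (half_space q :: ('a, 'b) half_vec set)"
    "h_inj South s + h_inj North n \<in> (half_space q :: ('a, 'b) half_vec set)"
    "s \<in> half_line" "n \<in> half_line" "f \<in> seg q"
    using x by (auto simp: sn half_space_def h_inj_def e_inj_def)
  have split: "x = h_inj South s + h_inj North n + e_inj f"
    by (simp add: sn h_inj_def e_inj_def)
  show ?thesis
    unfolding split by (simp only: add mems h e)
qed

text \<open>Identifies the block inverted by \<open>schur\<close> with the \<open>K\<close> of the
  block equations.\<close>

lemma half_hsum_east:
  "snd (half_hsum M P (0, v)) = blk_ee M v + blk_vv P West West v"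
  by (simp add: half_hsum_def zero_prod_def blk_ee_def blk_vv_def e_proj_def e_inj_def v_proj_def
      v_inj_def split: prod.split)

text \<open>\<open>Kinv\<close> is carried along uninterpreted. The formulas result from evaluating
  \<open>schur\<close> on vectors with one nonzero side, and vanishing at 0 removes the absent
  variables.\<close>

context
  fixes B :: "('a::{real_inner, complete_space}, 'b::{real_inner, complete_space}) half_vec \<Rightarrow> ('a, 'b) half_vec"
    and Q :: "('a, 'b) rect_vec \<Rightarrow> ('a, 'b) rect_vec" and p q :: nat
    and Kinv :: "(nat \<Rightarrow> 'b) \<Rightarrow> (nat \<Rightarrow> 'b)"
  assumes B0: "B 0 = 0" and Q0: "Q 0 = 0"
  defines "Kinv \<equiv> inv_into (seg q) (\<lambda>x. blk_ee B x + blk_vv Q West West x)"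
begin

lemma schur_half_hsum:
  "schur (seg q) (half_hsum B Q) x =
    fst (half_hsum B Q (x, 0)) - fst (half_hsum B Q (0, Kinv (snd (half_hsum B Q (x, 0)))))"
  by (simp add: schur_def Let_def Kinv_def half_hsum_east)

lemmas blk_simps = blk_hh_def blk_hv_def blk_vh_def blk_vv_def blk_he_def blk_eh_def blk_ee_def
  h_proj_def h_inj_def v_proj_def v_inj_def e_proj_def e_inj_def

lemma blk_ee_half_hglue:
  assumes "x \<in> seg q"
  shows "blk_ee (half_hglue p q B Q) x =
    blk_vv Q East East x - blk_vv Q East West (Kinv (blk_vv Q West East x))"
  using assms B0 Q0 unfolding half_hglue_def schur_half_hsum
  by (simp add: blk_simps half_space_def DL_adj_zero half_hsum_def zero_prod_def split: prod.split)

text \<open>An East input reaches \<open>B\<close> only across the shared side, so the half-line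
  component has just the subtracted term, whereas the segment also receives a direct contribution of
  \<open>Q\<close>.\<close>

lemma blk_he_half_hglue:
  assumes "x \<in> seg q"
  shows "blk_he (half_hglue p q B Q) a x =
    DL p (- blk_he B a (Kinv (blk_vv Q West East x)),
          blk_hv Q a East x - blk_hv Q a West (Kinv (blk_vv Q West East x)))"
  using assms B0 Q0 unfolding half_hglue_def schur_half_hsum
  by (cases a) (simp_all add: blk_simps half_space_def DL_adj_zero half_hsum_def zero_prod_def
      split: prod.split)

text \<open>\<open>DL_adj\<close> distributes the input: \<open>w\<close> enters \<open>B\<close>
  and \<open>h\<close> enters \<open>Q\<close>, and both push on the shared side, whence the sum
  under \<open>Kinv\<close>.\<close>

lemma blk_hh_half_hglue:
  assumes "x \<in> half_line"
  shows "blk_hh (half_hglue p q B Q) a b x =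
    DL p (let (w, h) = DL_adj p x;
              y = Kinv (blk_eh B b w + blk_vh Q West b h)
          in (blk_hh B a b w, blk_hh Q a b h) - (blk_he B a y, blk_hv Q a West y))"
  using assms B0 Q0 unfolding half_hglue_def schur_half_hsum
  by (cases a; cases b) (simp_all add: blk_simps half_space_def DL_adj_zero half_hsum_def zero_prod_def
      split: prod.split)

end

section \<open>The equivalence\<close>

theorem theorem2p14:
  fixes sc1 :: "'k::real_or_complex \<Rightarrow> 'a::{real_inner, complete_space} \<Rightarrow> 'a"
    and ip1 :: "'a \<Rightarrow> 'a \<Rightarrow> 'k"
    and sc2 :: "'k \<Rightarrow> 'b::{real_inner, complete_space} \<Rightarrow> 'b"
    and ip2 :: "'b \<Rightarrow> 'b \<Rightarrow> 'k"
    and Q :: "('a, 'b) rect_vec \<Rightarrow> ('a, 'b) rect_vec"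
    and B :: "('a, 'b) half_vec \<Rightarrow> ('a, 'b) half_vec"
  assumes "fd_hilbert sc1 ip1" and "fd_hilbert sc2 ip2"
    and "Q \<in> face_operators sc1 ip1 sc2 ip2"
    and "B \<in> half_ops sc1 ip1 sc2 ip2 1"
  shows "west_fixed_point_id sc1 ip1 sc2 ip2 Q B \<longleftrightarrow>
    (let K = (\<lambda>x. blk_ee B x + blk_vv Q West West x);
         Kinv = inv_into (seg 1) K
     in (\<forall>x \<in> seg 1.
           blk_ee B x = blk_vv Q East East x - blk_vv Q East West (Kinv (blk_vv Q West East x))) \<and>
        (\<forall>a. \<forall>x \<in> seg 1.
           blk_he B a x =
           DL 1 (- blk_he B a (Kinv (blk_vv Q West East x)),
                 blk_hv Q a East x - blk_hv Q a West (Kinv (blk_vv Q West East x)))) \<and>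
        (\<forall>a b. \<forall>x \<in> half_line.
           blk_hh B a b x =
           DL 1 (let (w, h) = DL_adj 1 x;
                     y = Kinv (blk_eh B b w + blk_vh Q West b h)
                 in (blk_hh B a b w, blk_hh Q a b h) - (blk_he B a y, blk_hv Q a West y))))"
proof -
  note B = half_ops_coercive[OF assms(1,2,4)] and Q = face_operators_coercive[OF assms(1-3)]
  have linB: "linear_sqs (half_space 1) (half_space 1) B" and linQ: "linear_sqs (rect_space 1 1) (rect_space 1 1) Q"
    using B Q by (simp_all add: coercive_op_def)
  have zero: "B 0 = 0" "Q 0 = 0"
    using linear_sqs_zero[OF linB] linear_sqs_zero[OF linQ] by simp_all
  let ?S = "half_hglue 1 1 B Q"
  have "?S = B" if ee: "\<forall>x\<in>seg 1. blk_ee B x = blk_ee ?S x" and he: "\<forall>a. \<forall>x\<in>seg 1. blk_he B a x = blk_he ?S a x"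
    and hh: "\<forall>a b. \<forall>x\<in>half_line. blk_hh B a b x = blk_hh ?S a b x"
  proof
    fix x
    show "?S x = B x"
    proof (cases "x \<in> half_space 1")
      case False
      then show ?thesis
        using assms(4) by (auto simp: half_hglue_def half_ops_def lin_ops_def)
    next
      case True
      have mem: "?S x \<in> half_space 1" if x1: "x \<in> half_space 1" for x
      proof -
        obtain s n e where x: "x = (s, n, e)" "s \<in> half_line" "n \<in> half_line" "e \<in> seg 1"
          using x1 by (auto simp: half_space_def)
        obtain s1 s' where s: "s1 \<in> half_line" "s' \<in> seg 1" "s = DL 1 (s1, s')" using DL_obtain[OF x(2)] .
        obtain n1 n' where n: "n1 \<in> half_line" "n' \<in> seg 1" "n = DL 1 (n1, n')" using DL_obtain[OF x(3)] .
        obtain v ys yn m ys' yn' ye where v: "v \<in> seg 1" "B (s1, n1, v) = (ys, yn, m)"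
          "Q (s', n', v, e) = (ys', yn', - m, ye)" "?S x = (DL 1 (ys, ys'), DL 1 (yn, yn'), ye)"
          using half_hglue_obtain[OF B(1) Q(1) s(1,2) n(1,2) x(4)] x(1) s(3) n(3) by metis
        then show ?thesis
          using coercive_op_half_memD[OF B(1) s(1) n(1) v(1,2)]
            coercive_op_rect_memD[OF Q(1) s(2) n(2) v(1) x(4) v(3)]
          by (simp add: half_space_def DL_mem)
      qed
      show ?thesis
        by (rule half_op_eqI[where q = 1])
          (use ee he hh True mem linear_sqs_mem[OF linB] linear_sqs_add[OF linB] half_hglue_add[OF B(1) Q(1)]
             B(2) symmetric_op_half_hglue[OF assms(1) B Q] in auto)
    qed
  qed
  then have "?S = B \<longleftrightarrow> (\<forall>x\<in>seg 1. blk_ee B x = blk_ee ?S x) \<and> (\<forall>a. \<forall>x\<in>seg 1. blk_he B a x = blk_he ?S a x) \<and>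
      (\<forall>a b. \<forall>x\<in>half_line. blk_hh B a b x = blk_hh ?S a b x)"
    by auto
  moreover have "west_fixed_point_id sc1 ip1 sc2 ip2 Q B \<longleftrightarrow> ?S = B"
  proof
    assume "west_fixed_point_id sc1 ip1 sc2 ip2 Q B"
    then have "half_hglue 1 1 (half_stack B 1) (grid Q 1 1) = half_stack B 1"
      unfolding west_fixed_point_id_def by blast
    then show "?S = B" by simp
  next
    assume "?S = B"
    then show "west_fixed_point_id sc1 ip1 sc2 ip2 Q B"
      unfolding west_fixed_point_id_def using half_hglue_grid[OF B(1) Q(1)] assms(4) by simp
  qed
  \<comment> \<open>The block formulas hold on the carriers only; the bounded quantifiers supply the
    membership.\<close>
  ultimately show ?thesis
    unfolding Let_def[of "\<lambda>x. blk_ee B x + blk_vv Q West West x"] Let_def[of "inv_into _ _"]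
    by (simp only: blk_ee_half_hglue[of B Q, OF zero] blk_he_half_hglue[of B Q, OF zero]
        blk_hh_half_hglue[of B Q, OF zero] cong: ball_cong)
qed

end
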